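(* Let $X=(X_t)_{t\in\mathbb Z}$ be a strictly stationary real-valued sequence with stationary distribution function $F$. Assume that $F$ is absolutely continuous and in the domain of attraction of the generalized extreme value distribution with index $\gamma\in\mathbb R$, with normalizing sequences $(u_n)$, $(v_n)$ and $w_n(x)=x/u_n+v_n$, and that, for $1+\gamma x>0$, $$\lim_{n\to\infty}\frac{\partial}{\partial x}F^n(w_n(x))=\frac{\partial}{\partial x}G_\gamma(x).$$ Let $(a_n)$ be a sequence of positive integers with $a_n=o(n)$ and such that, for $1+\gamma x>0$, $$\lim_{n\to\infty}\frac{\mathbb P(M_{a_n}>w_n(x))}{a_n\bar F(w_n(x))}=\theta\in(0,1].$$ Assume that there exists a sequence $(l_n)$ of positive integers with $l_n=o(a_n)$ as $n\to\infty$. If $X$ is $\eta$-weakly dependent and $$\frac n{a_n}\left(n\,\eta(l_n)u_n\right)^{1/2}\to_{n\to\infty}0,$$ or if $X$ is $\lambda$-weakly dependent and $$\frac n{a_n}\left(\left[n\lambda(l_n)u_n\right]^{1/2}\vee\left[na_n\lambda(l_n)u_n^2\right]^{1/3}\right)\to_{n\to\infty}0,$$ then $$\lim_{n\to\infty}\mathbb P(M_n\le w_n(x))=\begin{cases}\exp\left(-\theta(1+\gamma x)_+^{-1/\gamma}\right)&\text{if }\gamma\ne0,\\ \exp(-\theta\exp(-x))&\text{if }\gamma=0.\end{cases}$$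
   Context: $M_n=\max(X_1,\dots,X_n)$, $\bar F=1-F$, $x_F=\sup\{x:F(x)<1\}$, $\vee$ is the maximum. $F$ is in the domain of attraction of the generalized extreme value distribution with index $\gamma$ if there is a positive measurable function $g$ such that $\lim_{u\to x_F}\bar F(u+xg(u))/\bar F(u)=(1+\gamma x)^{-1/\gamma}$ for $1+\gamma x>0$ (read as $e^{-x}$ if $\gamma=0$). Then there are sequences $(u_n)$, $(v_n)$ with $u_n>0$ and $\lim_{n\to\infty}F^n(w_n(x))=G_\gamma(x)$, where $w_n(x)=x/u_n+v_n$ and $G_\gamma(x)=\exp(-(1+\gamma x)_+^{-1/\gamma})$ if $\gamma\ne0$, $G_0(x)=\exp(-\exp(-x))$. With $q(t)=F^{\leftarrow}(1-t^{-1})$ ($F^\leftarrow$ the generalized inverse), these can be chosen as $v_n=q(n)$ and $u_n^{-1}=(-\gamma)(x_F-q(n))$ if $\gamma<0$, $u_n^{-1}=q(ne)-q(n)$ if $\gamma=0$, $u_n^{-1}=\gamma q(n)$ if $\gamma>0$. Weak dependence: for $h:\mathbb R^u\to\mathbb R$, $\mathrm{Lip}\,h=\sup_{x\ne y}\frac{|h(y_1,\dots,y_u)-h(x_1,\dots,x_u)|}{|y_1-x_1|+\cdots+|y_u-x_u|}$. For a functional $\Psi$, put $$\varepsilon(r)=\sup\frac{|\mathrm{Cov}(f(X_{s_1},\dots,X_{s_u}),g(X_{t_1},\dots,X_{t_v}))|}{\Psi(f,g)},$$ the supremum being over $u,v\ge1$, $s_1\le\dots\le s_u\le t_1\le\dots\le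 t_v$ with $r=t_1-s_u$, and $f:\mathbb R^u\to\mathbb R$, $g:\mathbb R^v\to\mathbb R$ with $\mathrm{Lip}\,f,\mathrm{Lip}\,g<\infty$, $\|f\|_\infty\le1$, $\|g\|_\infty\le1$ (with $0/0=0$). With $\Psi(f,g)=u\,\mathrm{Lip}f+v\,\mathrm{Lip}g$ write $\varepsilon(r)=\eta(r)$; with $\Psi(f,g)=u\,\mathrm{Lip}f+v\,\mathrm{Lip}g+uv\,\mathrm{Lip}f\cdot\mathrm{Lip}g$ write $\varepsilon(r)=\lambda(r)$. $X$ is $\eta$-weakly (resp. $\lambda$-weakly) dependent if $\eta(r)\to0$ (resp. $\lambda(r)\to0$) as $r\to\infty$. *)

theory Defs
  imports "HOL-Probability.Probability" "HOL-Library.Landau_Symbols"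
begin

definition strictly_stationary :: "'a measure \<Rightarrow> (int \<Rightarrow> 'a \<Rightarrow> real) \<Rightarrow> bool" where
  "strictly_stationary M X \<longleftrightarrow>
     (\<forall>t. X t \<in> borel_measurable M) \<and>
     (\<forall>J h. finite J \<longrightarrow>
        distr M (Pi\<^sub>M J (\<lambda>_. borel)) (\<lambda>\<omega>. \<lambda>t\<in>J. X (t + h) \<omega>) =
        distr M (Pi\<^sub>M J (\<lambda>_. borel)) (\<lambda>\<omega>. \<lambda>t\<in>J. X t \<omega>))"

text \<open>Only meaningful for \<open>n \<ge> 1\<close>; all uses below are asymptotic in \<open>n\<close>.\<close>

definition partial_max :: "(int \<Rightarrow> 'a \<Rightarrow> real) \<Rightarrow> nat \<Rightarrow> 'a \<Rightarrow> real" where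
  "partial_max X n \<omega> = (MAX i\<in>{1..n}. X (int i) \<omega>)"

definition right_endpoint :: "(real \<Rightarrow> real) \<Rightarrow> ereal" where
  "right_endpoint F = (SUP x\<in>{x. F x < 1}. ereal x)"

definition to_right_endpoint :: "(real \<Rightarrow> real) \<Rightarrow> real filter" where
  "to_right_endpoint F =
     (if right_endpoint F = \<infinity> then at_top else at_left (real_of_ereal (right_endpoint F)))"

definition gev_domain_of_attraction :: "(real \<Rightarrow> real) \<Rightarrow> real \<Rightarrow> bool" where
  "gev_domain_of_attraction F \<gamma> \<longleftrightarrow>
     (\<exists>g. g \<in> borel_measurable borel \<and> (\<forall>u. g u > 0) \<and>
        (\<forall>x. 1 + \<gamma> * x > 0 \<longrightarrow>
           ((\<lambda>u. (1 - F (u + x * g u)) / (1 - F u)) \<longlongrightarrow>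
              (if \<gamma> = 0 then exp (- x) else (1 + \<gamma> * x) powr (- 1 / \<gamma>)))
             (to_right_endpoint F)))"

text \<open>
  \<open>exp (- \<theta> (1 + \<gamma> x)\<^sub>+ powr (- 1 / \<gamma>))\<close> for \<open>\<theta> > 0\<close>. Where \<open>1 + \<gamma> x \<le> 0\<close>, the power
  of the positive part is \<open>\<infinity>\<close> for \<open>\<gamma> > 0\<close> and \<open>0\<close> for \<open>\<gamma> < 0\<close>; these values are given
  explicitly because in HOL \<open>0 powr a = 0\<close> for every \<open>a\<close>.
\<close>

definition gev_theta :: "real \<Rightarrow> real \<Rightarrow> real \<Rightarrow> real" where
  "gev_theta \<theta> \<gamma> x =
     (if \<gamma> = 0 then exp (- \<theta> * exp (- x))
      else if 1 + \<gamma> * x > 0 then exp (- \<theta> * (1 + \<gamma> * x) powr (- 1 / \<gamma>))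
      else if \<gamma> > 0 then 0 else 1)"

definition gev :: "real \<Rightarrow> real \<Rightarrow> real" where
  "gev \<gamma> = gev_theta 1 \<gamma>"

definition norm_level :: "(nat \<Rightarrow> real) \<Rightarrow> (nat \<Rightarrow> real) \<Rightarrow> nat \<Rightarrow> real \<Rightarrow> real" where
  "norm_level u v n x = x / u n + v n"

definition gev_normalizing ::
  "(real \<Rightarrow> real) \<Rightarrow> real \<Rightarrow> (nat \<Rightarrow> real) \<Rightarrow> (nat \<Rightarrow> real) \<Rightarrow> bool" where
  "gev_normalizing F \<gamma> u v \<longleftrightarrow>
     (\<forall>n. u n > 0) \<and> (\<forall>x. (\<lambda>n. F (norm_level u v n x) ^ n) \<longlonglongrightarrow> gev \<gamma> x)"

text \<open>
  A function on \<open>\<real>\<^sup>k\<close> is modelled by its values on the real lists of length \<open>k\<close>. Lipschitz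
  constants and dependence coefficients may be infinite, so both take values in \<^typ>\<open>ennreal\<close>.
\<close>

definition Lip :: "nat \<Rightarrow> (real list \<Rightarrow> real) \<Rightarrow> ennreal" where
  "Lip k h = (SUP (xs, ys)\<in>{(xs, ys). length xs = k \<and> length ys = k \<and> xs \<noteq> ys}.
     ennreal (\<bar>h ys - h xs\<bar> / (\<Sum>i<k. \<bar>ys ! i - xs ! i\<bar>)))"

definition admissible :: "nat \<Rightarrow> (real list \<Rightarrow> real) \<Rightarrow> bool" where
  "admissible k h \<longleftrightarrow> Lip k h < \<top> \<and> (\<forall>xs. length xs = k \<longrightarrow> \<bar>h xs\<bar> \<le> 1)"

definition covariance :: "'a measure \<Rightarrow> ('a \<Rightarrow> real) \<Rightarrow> ('a \<Rightarrow> real) \<Rightarrow> real" where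
  "covariance M Y Z =
     (\<integral>\<omega>. (Y \<omega> - (\<integral>\<omega>'. Y \<omega>' \<partial>M)) * (Z \<omega> - (\<integral>\<omega>'. Z \<omega>' \<partial>M)) \<partial>M)"

text \<open>
  The lists \<open>ss\<close> and \<open>ts\<close> hold the times \<open>s\<^sub>1 \<le> \<dots> \<le> s\<^sub>u \<le> t\<^sub>1 \<le> \<dots> \<le> t\<^sub>v\<close>, and their lengths
  are the dimensions \<open>u\<close> and \<open>v\<close>. Division in \<^typ>\<open>ennreal\<close> satisfies \<open>0 / 0 = 0\<close>.
\<close>

definition dep_coeff ::
  "(nat \<Rightarrow> (real list \<Rightarrow> real) \<Rightarrow> nat \<Rightarrow> (real list \<Rightarrow> real) \<Rightarrow> ennreal) \<Rightarrow>
   'a measure \<Rightarrow> (int \<Rightarrow> 'a \<Rightarrow> real) \<Rightarrow> nat \<Rightarrow> ennreal" where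
  "dep_coeff \<Psi> M X r =
     (SUP (ss, ts, f, g)\<in>{(ss, ts, f, g).
          ss \<noteq> [] \<and> ts \<noteq> [] \<and> sorted (ss @ ts) \<and> int r = hd ts - last ss \<and>
          admissible (length ss) f \<and> admissible (length ts) g}.
        ennreal \<bar>covariance M (\<lambda>\<omega>. f (map (\<lambda>s. X s \<omega>) ss)) (\<lambda>\<omega>. g (map (\<lambda>t. X t \<omega>) ts))\<bar>
          / \<Psi> (length ss) f (length ts) g)"

definition eta_coeff :: "'a measure \<Rightarrow> (int \<Rightarrow> 'a \<Rightarrow> real) \<Rightarrow> nat \<Rightarrow> ennreal" where
  "eta_coeff = dep_coeff (\<lambda>u f v g. of_nat u * Lip u f + of_nat v * Lip v g)"

definition lambda_coeff :: "'a measure \<Rightarrow> (int \<Rightarrow> 'a \<Rightarrow> real) \<Rightarrow> nat \<Rightarrow> ennreal" where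
  "lambda_coeff = dep_coeff (\<lambda>u f v g.
     of_nat u * Lip u f + of_nat v * Lip v g + of_nat u * of_nat v * Lip u f * Lip v g)"

definition eta_weakly_dependent :: "'a measure \<Rightarrow> (int \<Rightarrow> 'a \<Rightarrow> real) \<Rightarrow> bool" where
  "eta_weakly_dependent M X \<longleftrightarrow> eta_coeff M X \<longlonglongrightarrow> 0"

definition lambda_weakly_dependent :: "'a measure \<Rightarrow> (int \<Rightarrow> 'a \<Rightarrow> real) \<Rightarrow> bool" where
  "lambda_weakly_dependent M X \<longleftrightarrow> lambda_coeff M X \<longlonglongrightarrow> 0"

definition ennroot :: "nat \<Rightarrow> ennreal \<Rightarrow> ennreal" where
  "ennroot k x = (if x = \<top> then \<top> else ennreal (root k (enn2real x)))"

end

theory Submission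
  imports Defs "HOL-Real_Asymp.Real_Asymp"
begin

text \<open>
  Write $\tau(x)$ for the exponent with $G_\gamma(x) = \exp(-\tau(x))$. The limit $F^n(w_n(x)) \to
  G_\gamma(x)$ says that $n (1 - F(w_n(x))) \to \tau(x)$, and the hypothesis on the extremal index
  then says that, among $n/a_n$ blocks of length $a_n$, the expected number of blocks with a value
  above $w_n(x)$ tends to $\theta\,\tau(x)$: $(n/a_n)\,P(M_{a_n} > w_n(x)) \to \theta\,\tau(x)$. If the blocks were
  independent, $P(M_n \le w_n(x))$ would be close to $P(M_{a_n} \le w_n(x))^{n/a_n}$, which tends to
  $\exp(-\theta\,\tau(x))$. The proof makes the blocks nearly independent, in three steps.

  Separation: the last $l_n - 1$ indices of each block are dropped, so that consecutive blocks lie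
  exactly $l_n$ apart. As $l_n = o(a_n)$, this changes the probabilities by a
  vanishing amount (\<open>block_approximation\<close>).

  Smoothing: weak dependence controls covariances of Lipschitz functions only, so the indicator of
  $\max \le w$ is replaced by a ramp that falls from 1 to 0 on $[w, w + \epsilon_n / u_n]$. Its
  Lipschitz constant is $u_n / \epsilon_n$, whatever the number of variables. The covariance of two
  ramps is at most $2 \epsilon_n$ if $\epsilon_n$ balances the two sides of this estimate, which
  gives the square and cube roots of the hypothesis (\<open>eta_smoothing_scale\<close>,
  \<open>lambda_smoothing_scale\<close>). The cost of the ramp is of the order of $n$ times the probability that
  $X_0$ falls in the window $(w, w + \epsilon_n / u_n]$ (\<open>quasi_independence\<close>). Both errors are
  made $n/a_n$ times, and $(n/a_n)\,\epsilon_n \to 0$, so it remains to see that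
  $n (F(w_n(y + \epsilon_n)) - F(w_n(y))) = O(\epsilon_n)$.

  Choice of the level: this bound may fail at a given $y$, but the increments of $n F(w_n(\cdot))$
  over the windows in an interval $[x, x']$ add up to at most
  $n (1 - F(w_n(x)))$, which is bounded, so some window in $[x, x']$ carries at most its share (\<open>pigeonhole_increment\<close>). A level
  $y_n \in [x, x']$ that depends on $n$ is good enough, since all probabilities are monotone in the
  level and the limit is continuous (\<open>tendsto_of_close_mono\<close>). Monotonicity also settles the levels
  outside the support of $G_\gamma$.
\<close>

section \<open>Smoothed indicators of maxima\<close>

definition ramp :: "real \<Rightarrow> real \<Rightarrow> real \<Rightarrow> real" where
  "ramp w e z = max 0 (min 1 ((w + e - z) / e))"

lemma ramp_nonneg: "0 \<le> ramp w e z"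
  and ramp_le_1: "ramp w e z \<le> 1"
  by (auto simp: ramp_def)

lemma ramp_eq_1: "e > 0 \<Longrightarrow> z \<le> w \<Longrightarrow> ramp w e z = 1"
  and ramp_eq_0: "e > 0 \<Longrightarrow> w + e \<le> z \<Longrightarrow> ramp w e z = 0"
  by (auto simp: ramp_def max_def min_def field_simps)

lemma ramp_lipschitz:
  assumes "e > 0"
  shows "\<bar>ramp w e z' - ramp w e z\<bar> \<le> \<bar>z' - z\<bar> / e"
proof -
  have "\<bar>ramp w e z' - ramp w e z\<bar> \<le> \<bar>(w + e - z') / e - (w + e - z) / e\<bar>"
    unfolding ramp_def by (auto simp: max_def min_def)
  also have "(w + e - z') / e - (w + e - z) / e = (z - z') / e"
    by (simp add: diff_divide_distrib [symmetric])
  finally show ?thesis using assms by (simp add: abs_minus_commute)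
qed

text \<open>
  The maximum is 1-Lipschitz for the sum norm, so a ramp of slope $1/e$ composed with it has
  Lipschitz constant at most $1/e$ in every dimension. Hence the width of the ramps need not depend
  on the number of variables.
\<close>

lemma Max_diff_le_sum:
  fixes xs ys :: "real list"
  assumes "length xs = k" "length ys = k" "k > 0"
  shows "Max (set xs) - Max (set ys) \<le> (\<Sum>i<k. \<bar>xs ! i - ys ! i\<bar>)"
proof -
  have "Max (set xs) \<in> set xs" using assms by (intro Max_in) auto
  then obtain i where i: "i < k" "Max (set xs) = xs ! i"
    using assms by (auto simp: in_set_conv_nth)
  have "ys ! i \<le> Max (set ys)" using i assms by (intro Max_ge) auto
  moreover have "\<bar>xs ! i - ys ! i\<bar> \<le> (\<Sum>i<k. \<bar>xs ! i - ys ! i\<bar>)"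
    using i by (intro member_le_sum) auto
  ultimately show ?thesis using i by linarith
qed

lemma Lip_ramp_Max:
  assumes "e > 0" "k > 0"
  shows "Lip k (\<lambda>zs. ramp w e (Max (set zs))) \<le> ennreal (1 / e)"
  unfolding Lip_def
proof (rule SUP_least, clarsimp)
  fix xs ys :: "real list"
  assume len: "length ys = length xs" "k = length xs"
  let ?S = "\<Sum>i<length xs. \<bar>ys ! i - xs ! i\<bar>"
  have "\<bar>Max (set ys) - Max (set xs)\<bar> \<le> ?S"
    using Max_diff_le_sum[of xs "length xs" ys] Max_diff_le_sum[of ys "length xs" xs] len assms
    by (simp add: abs_le_iff abs_minus_commute)
  then have "\<bar>ramp w e (Max (set ys)) - ramp w e (Max (set xs))\<bar> \<le> ?S / e"
    using ramp_lipschitz[OF assms(1), of w "Max (set ys)" "Max (set xs)"] assms(1)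
    by (meson divide_right_mono less_eq_real_def order_trans)
  moreover have "?S \<ge> 0" by (simp add: sum_nonneg)
  ultimately have "\<bar>ramp w e (Max (set ys)) - ramp w e (Max (set xs))\<bar> / ?S \<le> ?S / e / ?S"
    by (rule divide_right_mono)
  also have "\<dots> \<le> 1 / e" using assms(1) by (cases "?S = 0") auto
  finally have "\<bar>ramp w e (Max (set ys)) - ramp w e (Max (set xs))\<bar> / ?S \<le> 1 / e" .
  then show "ennreal (\<bar>ramp w e (Max (set ys)) - ramp w e (Max (set xs))\<bar> / ?S) \<le> ennreal (1 / e)"
    by (rule ennreal_leI)
qed

lemma admissible_ramp_Max:
  assumes "e > 0" "k > 0"
  shows "admissible k (\<lambda>zs. ramp w e (Max (set zs)))"
  using Lip_ramp_Max[OF assms, of w] ramp_nonneg ramp_le_1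
  by (auto simp: admissible_def less_top[symmetric] top_unique abs_le_iff
      intro: order_trans[OF _ ramp_nonneg])

section \<open>Covariances of smoothed indicators\<close>

lemma sorted_list_of_set_hd_last:
  fixes I :: "int set"
  assumes "finite I" "I \<noteq> {}"
  shows "hd (sorted_list_of_set I) = Min I" "last (sorted_list_of_set I) = Max I"
proof -
  let ?l = "sorted_list_of_set I"
  have ne: "?l \<noteq> []" and set: "set ?l = I" and so: "sorted ?l" using assms by auto
  show "hd ?l = Min I"
    using assms by (simp add: sorted_list_of_set_nonempty)
  show "last ?l = Max I"
  proof (rule Max_eqI [symmetric])
    show "last ?l \<in> I" using last_in_set[OF ne] set by simp
    fix y assume "y \<in> I"
    then show "y \<le> last ?l" using so set ne
      by (metis append_butlast_last_id in_set_conv_decomp_last last.simps last_append last_in_set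
          sorted_append order_refl list.simps(3) set_ConsD sorted_simps(2))
  qed (use assms in auto)
qed

text \<open>
  The supremum that defines a dependence coefficient ranges over quotients. Finiteness of \<open>c\<close> excludes
  a zero denominator under a nonzero numerator, where the quotient is \<^term>\<open>top\<close>.
\<close>

lemma ennreal_le_mult_of_divide_le:
  fixes x \<Psi> c :: ennreal
  assumes "x / \<Psi> \<le> c" "c < top" "\<Psi> < top"
  shows "x \<le> c * \<Psi>"
proof (cases "\<Psi> = 0")
  case True
  with assms have "x = 0"
    by (metis ennreal_divide_eq_top_iff less_le_not_le top_greatest)
  then show ?thesis by simp
next
  case False
  then have "x = (x / \<Psi>) * \<Psi>"
    using assms by (simp add: ennreal_divide_times ennreal_mult_divide_eq)
  also have "\<dots> \<le> c * \<Psi>" using assms(1) by (rule mult_right_mono) simp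
  finally show ?thesis .
qed

definition smooth_below :: "(int \<Rightarrow> 'a \<Rightarrow> real) \<Rightarrow> int set \<Rightarrow> real \<Rightarrow> real \<Rightarrow> 'a \<Rightarrow> real" where
  "smooth_below X I w e \<omega> = ramp w e (MAX t\<in>I. X t \<omega>)"

text \<open>
  Common to both kinds of weak dependence: the ramps of the two maxima are among the test functions
  of the coefficient at distance \<open>r\<close>, and \<open>B\<close> bounds the functional on pairs of functions
  with Lipschitz constants at most \<open>1 / e\<close>. The distance must be exactly \<open>r\<close>, since a coefficient
  says nothing about other distances.
\<close>

lemma covariance_smooth_below_le:
  fixes M :: "'a measure"
  assumes I: "finite I" "I \<noteq> {}" and J: "finite J" "J \<noteq> {}"
    and gap: "int r = Min J - Max I" and e: "e > 0"
    and coeff: "dep_coeff \<Psi> M X r = ennreal c" and "c \<ge> 0" "B \<ge> 0"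
    and \<Psi>: "\<And>f g. Lip (card I) f \<le> ennreal (1 / e) \<Longrightarrow> Lip (card J) g \<le> ennreal (1 / e) \<Longrightarrow>
      \<Psi> (card I) f (card J) g \<le> ennreal B"
  shows "\<bar>covariance M (smooth_below X I w e) (smooth_below X J w e)\<bar> \<le> c * B"
proof -
  let ?h = "\<lambda>zs. ramp w e (Max (set zs))"
  let ?ss = "sorted_list_of_set I" and ?ts = "sorted_list_of_set J"
  let ?cov = "\<lambda>(ss, ts, f, g). ennreal \<bar>covariance M (\<lambda>\<omega>. f (map (\<lambda>s. X s \<omega>) ss))
      (\<lambda>\<omega>. g (map (\<lambda>t. X t \<omega>) ts))\<bar> / \<Psi> (length ss) f (length ts) g"
  have card: "card I > 0" "card J > 0" using I J by (auto simp: card_gt_0_iff)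
  have le: "s \<le> t" if "s \<in> I" "t \<in> J" for s t
    using Max_ge[OF I(1) that(1)] Min_le[OF J(1) that(2)] gap by linarith
  have "?cov (?ss, ?ts, ?h, ?h) \<le> dep_coeff \<Psi> M X r"
    unfolding dep_coeff_def
    using I J le gap card e
    by (intro SUP_upper) (simp add: sorted_append sorted_list_of_set_hd_last admissible_ramp_Max)
  then have "ennreal \<bar>covariance M (smooth_below X I w e) (smooth_below X J w e)\<bar>
      / \<Psi> (card I) ?h (card J) ?h \<le> ennreal c"
    using I J coeff by (simp add: smooth_below_def [abs_def])
  moreover have le: "\<Psi> (card I) ?h (card J) ?h \<le> ennreal B"
    by (intro \<Psi> Lip_ramp_Max e card)
  moreover have "\<Psi> (card I) ?h (card J) ?h < top"
    using le by (simp add: order_le_less_trans)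
  ultimately have "ennreal \<bar>covariance M (smooth_below X I w e) (smooth_below X J w e)\<bar>
      \<le> ennreal c * \<Psi> (card I) ?h (card J) ?h"
    by (intro ennreal_le_mult_of_divide_le) auto
  also have "\<dots> \<le> ennreal c * ennreal B" using le by (rule mult_left_mono) simp
  also have "\<dots> = ennreal (c * B)" using assms by (simp add: ennreal_mult)
  finally show ?thesis using assms by (simp add: ennreal_le_iff)
qed

lemma covariance_eta_le:
  assumes I: "finite I" "I \<noteq> {}" and J: "finite J" "J \<noteq> {}"
    and gap: "int r = Min J - Max I" and e: "e > 0"
    and coeff: "eta_coeff M X r = ennreal c" and c: "c \<ge> 0"
  shows "\<bar>covariance M (smooth_below X I w e) (smooth_below X J w e)\<bar>
    \<le> c * ((card I + card J) / e)"
proof (rule covariance_smooth_below_le[OF I J gap e coeff[unfolded eta_coeff_def] c])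
  fix f g
  assume "Lip (card I) f \<le> ennreal (1 / e)" "Lip (card J) g \<le> ennreal (1 / e)"
  then have "of_nat (card I) * Lip (card I) f + of_nat (card J) * Lip (card J) g
      \<le> of_nat (card I) * ennreal (1 / e) + of_nat (card J) * ennreal (1 / e)"
    by (intro add_mono mult_left_mono) auto
  also have "\<dots> = ennreal ((card I + card J) / e)"
    using e by (simp add: ennreal_of_nat_eq_real_of_nat ennreal_mult [symmetric] add_divide_distrib
        ennreal_plus [symmetric] del: ennreal_plus)
  finally show "of_nat (card I) * Lip (card I) f + of_nat (card J) * Lip (card J) g
      \<le> ennreal ((card I + card J) / e)" .
qed (use e in simp)

lemma covariance_lambda_le:
  assumes I: "finite I" "I \<noteq> {}" and J: "finite J" "J \<noteq> {}"
    and gap: "int r = Min J - Max I" and e: "e > 0"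
    and coeff: "lambda_coeff M X r = ennreal c" and c: "c \<ge> 0"
  shows "\<bar>covariance M (smooth_below X I w e) (smooth_below X J w e)\<bar>
    \<le> c * ((card I + card J) / e + real (card I) * card J / e\<^sup>2)"
proof (rule covariance_smooth_below_le[OF I J gap e coeff[unfolded lambda_coeff_def] c])
  fix f g
  assume "Lip (card I) f \<le> ennreal (1 / e)" "Lip (card J) g \<le> ennreal (1 / e)"
  then have "of_nat (card I) * Lip (card I) f + of_nat (card J) * Lip (card J) g
        + of_nat (card I) * of_nat (card J) * Lip (card I) f * Lip (card J) g
      \<le> of_nat (card I) * ennreal (1 / e) + of_nat (card J) * ennreal (1 / e)
        + of_nat (card I) * of_nat (card J) * ennreal (1 / e) * ennreal (1 / e)"
    by (intro add_mono mult_mono) auto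
  also have "\<dots> = ennreal ((card I + card J) / e + real (card I) * card J / e\<^sup>2)"
    using e by (simp add: ennreal_of_nat_eq_real_of_nat ennreal_mult [symmetric] add_divide_distrib
        ennreal_plus [symmetric] power2_eq_square del: ennreal_plus)
  finally show "of_nat (card I) * Lip (card I) f + of_nat (card J) * Lip (card J) g
        + of_nat (card I) * of_nat (card J) * Lip (card I) f * Lip (card J) g
      \<le> ennreal ((card I + card J) / e + real (card I) * card J / e\<^sup>2)" .
qed (use e in simp)

section \<open>Block approximation for a stationary sequence\<close>

locale stationary_sequence = prob_space M for M :: "'a measure" +
  fixes X :: "int \<Rightarrow> 'a \<Rightarrow> real"
  assumes stationary: "strictly_stationary M X"
begin

definition marginal_cdf :: "real \<Rightarrow> real" where
  "marginal_cdf = cdf (distr M borel (X 0))"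

definition prob_below :: "int set \<Rightarrow> real \<Rightarrow> real" where
  "prob_below I w = prob {\<omega> \<in> space M. \<forall>t\<in>I. X t \<omega> \<le> w}"

lemma X_measurable [measurable]: "X t \<in> borel_measurable M"
  using stationary by (simp add: strictly_stationary_def)

lemma prob_below_shift:
  assumes "finite I"
  shows "prob_below ((\<lambda>t. t + h) ` I) w = prob_below I w"
proof -
  let ?P = "Pi\<^sub>M I (\<lambda>_. borel :: real measure)"
  let ?A = "{f \<in> space ?P. \<forall>t\<in>I. f t \<le> w}"
  have meas: "?A \<in> sets ?P" using assms by measurable
  have dis: "measure (distr M ?P (\<lambda>\<omega>. \<lambda>t\<in>I. X (t + h) \<omega>)) ?A
      = prob {\<omega> \<in> space M. \<forall>t\<in>I. X (t + h) \<omega> \<le> w}" for h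
    using meas
    by (subst measure_distr)
      (auto intro!: arg_cong[where f = prob] measurable_restrict simp: space_PiM)
  have "distr M ?P (\<lambda>\<omega>. \<lambda>t\<in>I. X (t + h) \<omega>) = distr M ?P (\<lambda>\<omega>. \<lambda>t\<in>I. X (t + 0) \<omega>)"
    using stationary assms by (simp add: strictly_stationary_def)
  then have "prob {\<omega> \<in> space M. \<forall>t\<in>I. X (t + h) \<omega> \<le> w}
      = prob {\<omega> \<in> space M. \<forall>t\<in>I. X (t + 0) \<omega> \<le> w}"
    using dis[of h] dis[of 0] by simp
  then show ?thesis by (simp add: prob_below_def)
qed

lemma prob_X_le: "prob {\<omega> \<in> space M. X t \<omega> \<le> w} = marginal_cdf w"
proof -
  have "prob_below ((\<lambda>s. s + t) ` {0}) w = prob_below {0} w"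
    by (rule prob_below_shift) simp
  moreover have "marginal_cdf w = prob {\<omega> \<in> space M. X 0 \<omega> \<le> w}"
    unfolding marginal_cdf_def cdf_def
    by (subst measure_distr) (auto intro!: arg_cong[where f = prob])
  ultimately show ?thesis by (simp add: prob_below_def)
qed

lemma prob_X_between:
  assumes "w \<le> w'"
  shows "prob {\<omega> \<in> space M. w < X t \<omega> \<and> X t \<omega> \<le> w'} = marginal_cdf w' - marginal_cdf w"
proof -
  have "{\<omega> \<in> space M. w < X t \<omega> \<and> X t \<omega> \<le> w'}
      = {\<omega> \<in> space M. X t \<omega> \<le> w'} - {\<omega> \<in> space M. X t \<omega> \<le> w}" by auto
  also have "prob \<dots> = marginal_cdf w' - marginal_cdf w"
    using assms unfolding prob_X_le[of t, symmetric] by (intro finite_measure_Diff) auto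
  finally show ?thesis .
qed

lemma prob_X_gt: "prob {\<omega> \<in> space M. X t \<omega> > w} = 1 - marginal_cdf w"
proof -
  have "{\<omega> \<in> space M. X t \<omega> > w} = space M - {\<omega> \<in> space M. X t \<omega> \<le> w}" by auto
  then show ?thesis using prob_X_le[of t w] by (simp add: prob_compl)
qed

lemma marginal_cdf_le_1: "marginal_cdf w \<le> 1"
  unfolding prob_X_le[of 0, symmetric] by simp

lemma marginal_cdf_nonneg: "0 \<le> marginal_cdf w"
  unfolding prob_X_le[of 0, symmetric] by simp

lemma marginal_cdf_mono: "w \<le> w' \<Longrightarrow> marginal_cdf w \<le> marginal_cdf w'"
  unfolding prob_X_le[of 0, symmetric] by (intro finite_measure_mono) auto

lemma prob_below_sets:
  "finite I \<Longrightarrow> {\<omega> \<in> space M. \<forall>t\<in>I. X t \<omega> \<le> w} \<in> events"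
  by measurable

lemma prob_below_nonneg: "0 \<le> prob_below I w"
  and prob_below_le_1: "prob_below I w \<le> 1"
  by (simp_all add: prob_below_def)

lemma prob_below_empty: "prob_below {} w = 1"
  by (simp add: prob_below_def prob_space)

lemma prob_below_mono:
  "finite I \<Longrightarrow> w \<le> w' \<Longrightarrow> prob_below I w \<le> prob_below I w'"
  unfolding prob_below_def by (intro finite_measure_mono prob_below_sets) (auto intro: order_trans)

lemma prob_below_antimono:
  "finite J \<Longrightarrow> I \<subseteq> J \<Longrightarrow> prob_below J w \<le> prob_below I w"
  unfolding prob_below_def
  by (intro finite_measure_mono prob_below_sets) (auto intro: finite_subset)

lemma prob_below_subset_diff_le:
  assumes "finite J" "I \<subseteq> J"
  shows "prob_below I w - prob_below J w \<le> card (J - I) * (1 - marginal_cdf w)"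
proof -
  let ?B = "\<lambda>I. {\<omega> \<in> space M. \<forall>t\<in>I. X t \<omega> \<le> w}"
  let ?U = "\<Union>t\<in>J - I. {\<omega> \<in> space M. X t \<omega> > w}"
  have fin: "finite I" using assms by (blast intro: finite_subset)
  have "prob_below I w \<le> prob (?B J \<union> ?U)"
    unfolding prob_below_def using assms
    by (intro finite_measure_mono sets.Un prob_below_sets sets.finite_UN) (auto simp: not_less)
  also have "\<dots> \<le> prob (?B J) + prob ?U"
    using assms by (intro measure_Un_le prob_below_sets sets.finite_UN) auto
  also have "prob ?U \<le> (\<Sum>t\<in>J - I. prob {\<omega> \<in> space M. X t \<omega> > w})"
    using assms by (intro finite_measure_subadditive_finite) auto
  also have "\<dots> = card (J - I) * (1 - marginal_cdf w)"
    by (simp add: prob_X_gt)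
  finally show ?thesis by (simp add: prob_below_def)
qed

text \<open>
  If all variables are below \<open>w'\<close> but not all below \<open>w\<close>, then one of them lies in the window
  between the two levels.
\<close>

lemma prob_below_level_diff_le:
  assumes "finite I" "w \<le> w'"
  shows "prob_below I w' - prob_below I w \<le> card I * (marginal_cdf w' - marginal_cdf w)"
proof -
  let ?B = "\<lambda>w. {\<omega> \<in> space M. \<forall>t\<in>I. X t \<omega> \<le> w}"
  let ?U = "\<Union>t\<in>I. {\<omega> \<in> space M. w < X t \<omega> \<and> X t \<omega> \<le> w'}"
  have "prob_below I w' \<le> prob (?B w \<union> ?U)"
    unfolding prob_below_def using assms
    by (intro finite_measure_mono sets.Un prob_below_sets sets.finite_UN) (auto simp: not_less)
  also have "\<dots> \<le> prob (?B w) + prob ?U"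
    using assms by (intro measure_Un_le prob_below_sets sets.finite_UN) auto
  also have "prob ?U \<le> (\<Sum>t\<in>I. prob {\<omega> \<in> space M. w < X t \<omega> \<and> X t \<omega> \<le> w'})"
    using assms by (intro finite_measure_subadditive_finite) auto
  also have "\<dots> = card I * (marginal_cdf w' - marginal_cdf w)"
    using assms by (simp add: prob_X_between)
  finally show ?thesis by (simp add: prob_below_def)
qed

lemma smooth_below_between_indicators:
  assumes "finite I" "I \<noteq> {}" "e > 0" "\<omega> \<in> space M"
  shows "indicator {\<omega> \<in> space M. \<forall>t\<in>I. X t \<omega> \<le> w} \<omega> \<le> smooth_below X I w e \<omega>"
    and "smooth_below X I w e \<omega> \<le> indicator {\<omega> \<in> space M. \<forall>t\<in>I. X t \<omega> \<le> w + e} \<omega>"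
proof -
  show "indicator {\<omega> \<in> space M. \<forall>t\<in>I. X t \<omega> \<le> w} \<omega> \<le> smooth_below X I w e \<omega>"
    using assms by (auto simp: smooth_below_def indicator_def ramp_nonneg ramp_eq_1)
  show "smooth_below X I w e \<omega> \<le> indicator {\<omega> \<in> space M. \<forall>t\<in>I. X t \<omega> \<le> w + e} \<omega>"
  proof (cases "\<forall>t\<in>I. X t \<omega> \<le> w + e")
    case True
    then show ?thesis using assms by (simp add: smooth_below_def ramp_le_1)
  next
    case False
    then have "w + e \<le> (MAX t\<in>I. X t \<omega>)"
      using assms by (subst Max_ge_iff) (auto simp: not_le intro: less_imp_le)
    then show ?thesis using assms by (simp add: smooth_below_def ramp_eq_0)
  qed
qed

lemma smooth_below_measurable:
  assumes "finite I" "I \<noteq> {}"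
  shows "smooth_below X I w e \<in> borel_measurable M"
proof -
  have "(\<lambda>\<omega>. MAX t\<in>I. X t \<omega>) \<in> borel_measurable M"
    using assms by (intro borel_measurable_Max) auto
  then show ?thesis unfolding smooth_below_def ramp_def by measurable
qed

lemma smooth_below_bounds: "0 \<le> smooth_below X I w e \<omega>" "smooth_below X I w e \<omega> \<le> 1"
  by (simp_all add: smooth_below_def ramp_nonneg ramp_le_1)

lemma integrable_smooth_below:
  assumes "finite I" "I \<noteq> {}"
  shows "integrable M (smooth_below X I w e)"
  using smooth_below_bounds smooth_below_measurable[OF assms]
  by (intro integrable_const_bound[where B = 1]) auto

lemma integrable_smooth_below_mult:
  assumes "finite I" "I \<noteq> {}" "finite J" "J \<noteq> {}"
  shows "integrable M (\<lambda>\<omega>. smooth_below X I w e \<omega> * smooth_below X J w e \<omega>)"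
  using smooth_below_bounds smooth_below_measurable[OF assms(1,2)] smooth_below_measurable[OF assms(3,4)]
  by (intro integrable_const_bound[where B = 1]) (auto simp: abs_mult mult_le_one)

lemma expectation_smooth_below:
  assumes "finite I" "I \<noteq> {}" "e > 0"
  shows "prob_below I w \<le> expectation (smooth_below X I w e)"
    and "expectation (smooth_below X I w e) \<le> prob_below I (w + e)"
proof -
  have *: "expectation (indicator {\<omega> \<in> space M. \<forall>t\<in>I. X t \<omega> \<le> w}) = prob_below I w" for w
    using prob_below_sets[OF assms(1)] by (simp add: prob_below_def)
  show "prob_below I w \<le> expectation (smooth_below X I w e)"
    unfolding *[symmetric] using assms
    by (intro integral_mono integrable_smooth_below smooth_below_between_indicators)
      (auto simp: prob_below_sets less_top[symmetric] intro!: integrable_real_indicator)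
  show "expectation (smooth_below X I w e) \<le> prob_below I (w + e)"
    unfolding *[symmetric] using assms
    by (intro integral_mono integrable_smooth_below smooth_below_between_indicators)
      (auto simp: prob_below_sets less_top[symmetric] intro!: integrable_real_indicator)
qed

lemma expectation_smooth_below_mult:
  assumes I: "finite I" "I \<noteq> {}" and J: "finite J" "J \<noteq> {}" and e: "e > 0"
  shows "prob_below (I \<union> J) w \<le>
      expectation (\<lambda>\<omega>. smooth_below X I w e \<omega> * smooth_below X J w e \<omega>)"
    and "expectation (\<lambda>\<omega>. smooth_below X I w e \<omega> * smooth_below X J w e \<omega>)
      \<le> prob_below (I \<union> J) (w + e)"
proof -
  let ?B = "\<lambda>I w. {\<omega> \<in> space M. \<forall>t\<in>I. X t \<omega> \<le> w}"
  have *: "expectation (\<lambda>\<omega>. indicator (?B I w) \<omega> * indicator (?B J w) \<omega>) = prob_below (I \<union> J) w"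
    and int: "integrable M (\<lambda>\<omega>. indicator (?B I w) \<omega> * indicator (?B J w) \<omega> :: real)" for w
  proof -
    have eq: "(\<lambda>\<omega>. indicator (?B I w) \<omega> * indicator (?B J w) \<omega> :: real) = indicator (?B (I \<union> J) w)"
      by (auto simp: indicator_def fun_eq_iff)
    have "?B (I \<union> J) w \<in> events" using I J by (intro prob_below_sets) auto
    then show "expectation (\<lambda>\<omega>. indicator (?B I w) \<omega> * indicator (?B J w) \<omega>) = prob_below (I \<union> J) w"
      "integrable M (\<lambda>\<omega>. indicator (?B I w) \<omega> * indicator (?B J w) \<omega> :: real)"
      unfolding eq by (simp_all add: prob_below_def less_top[symmetric])
  qed
  show "prob_below (I \<union> J) w \<le>
      expectation (\<lambda>\<omega>. smooth_below X I w e \<omega> * smooth_below X J w e \<omega>)"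
    unfolding *[symmetric] using assms
    by (intro integral_mono mult_mono int integrable_smooth_below_mult smooth_below_between_indicators
        smooth_below_bounds) auto
  show "expectation (\<lambda>\<omega>. smooth_below X I w e \<omega> * smooth_below X J w e \<omega>)
      \<le> prob_below (I \<union> J) (w + e)"
    unfolding *[symmetric] using assms
    by (intro integral_mono mult_mono int integrable_smooth_below_mult smooth_below_between_indicators
        smooth_below_bounds) auto
qed

lemma covariance_eq_expectation_diff:
  assumes "integrable M Y" "integrable M Z" "integrable M (\<lambda>\<omega>. Y \<omega> * Z \<omega>)"
  shows "covariance M Y Z = expectation (\<lambda>\<omega>. Y \<omega> * Z \<omega>) - expectation Y * expectation Z"
proof -
  let ?y = "expectation Y" and ?z = "expectation Z"
  have "covariance M Y Z
      = expectation (\<lambda>\<omega>. Y \<omega> * Z \<omega> - ?z * Y \<omega> - ?y * Z \<omega> + ?y * ?z)"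
    unfolding covariance_def by (simp add: algebra_simps)
  also have "\<dots> = expectation (\<lambda>\<omega>. Y \<omega> * Z \<omega>) - ?z * ?y - ?y * ?z + ?y * ?z"
    using assms by (simp add: prob_space)
  finally show ?thesis by simp
qed

text \<open>
  The ramps lie between the indicators at the levels \<open>w\<close> and \<open>w + e\<close>. Replacing the indicators by
  the ramps therefore costs at most the expected number of variables in the window, once in the
  joint probability and once in the product of the marginal ones; this gives the factor 2.
\<close>

lemma quasi_independence:
  assumes I: "finite I" "I \<noteq> {}" and J: "finite J" "J \<noteq> {}" and e: "e > 0"
    and D: "\<bar>covariance M (smooth_below X I w e) (smooth_below X J w e)\<bar> \<le> D"
  shows "\<bar>prob_below (I \<union> J) w - prob_below I w * prob_below J w\<bar>
    \<le> D + 2 * (card I + card J) * (marginal_cdf (w + e) - marginal_cdf w)"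
proof -
  let ?EI = "expectation (smooth_below X I w e)" and ?EJ = "expectation (smooth_below X J w e)"
  let ?E = "expectation (\<lambda>\<omega>. smooth_below X I w e \<omega> * smooth_below X J w e \<omega>)"
  let ?d = "marginal_cdf (w + e) - marginal_cdf w"
  have d: "?d \<ge> 0" using marginal_cdf_mono[of w "w + e"] e by simp
  have cov: "\<bar>?E - ?EI * ?EJ\<bar> \<le> D"
    using D I J by (simp add: covariance_eq_expectation_diff integrable_smooth_below
        integrable_smooth_below_mult)
  have "real (card (I \<union> J)) * ?d \<le> real (card I + card J) * ?d"
    by (intro mult_right_mono d of_nat_mono card_Un_le)
  then have joint: "0 \<le> ?E - prob_below (I \<union> J) w" "?E - prob_below (I \<union> J) w \<le> (card I + card J) * ?d"
    using expectation_smooth_below_mult[OF I J e, of w]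
      prob_below_level_diff_le[of "I \<union> J" w "w + e"] I J e by auto
  have i: "0 \<le> ?EI - prob_below I w" "?EI - prob_below I w \<le> card I * ?d"
    using expectation_smooth_below[OF I e, of w] prob_below_level_diff_le[of I w "w + e"] I e by auto
  have j: "0 \<le> ?EJ - prob_below J w" "?EJ - prob_below J w \<le> card J * ?d"
    using expectation_smooth_below[OF J e, of w] prob_below_level_diff_le[of J w "w + e"] J e by auto
  have EI: "0 \<le> ?EI" "?EI \<le> 1"
    using order_trans[OF prob_below_nonneg expectation_smooth_below(1)[OF I e]]
      order_trans[OF expectation_smooth_below(2)[OF I e] prob_below_le_1] by auto
  have "?EI * ?EJ - prob_below I w * prob_below J w
      = ?EI * (?EJ - prob_below J w) + (?EI - prob_below I w) * prob_below J w"
    by (simp add: algebra_simps)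
  moreover have "0 \<le> ?EI * (?EJ - prob_below J w)" using EI j by simp
  moreover have "?EI * (?EJ - prob_below J w) \<le> 1 * (card J * ?d)"
    using EI j by (intro mult_mono) auto
  moreover have "0 \<le> (?EI - prob_below I w) * prob_below J w" using i prob_below_nonneg by simp
  moreover have "(?EI - prob_below I w) * prob_below J w \<le> (card I * ?d) * 1"
    using i prob_below_nonneg prob_below_le_1 by (intro mult_mono) auto
  ultimately have prod: "0 \<le> ?EI * ?EJ - prob_below I w * prob_below J w"
    "?EI * ?EJ - prob_below I w * prob_below J w \<le> (card I + card J) * ?d"
    by (auto simp: algebra_simps)
  have "2 * (card I + card J) * ?d = (card I + card J) * ?d + (card I + card J) * ?d"
    by (simp add: algebra_simps)
  then show ?thesis using cov joint prod unfolding abs_le_iff by linarith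
qed

end

definition block :: "nat \<Rightarrow> nat \<Rightarrow> nat \<Rightarrow> int set" where
  "block a b i = {int (i * a) + 1 .. int (i * a) + int b}"

definition blocks :: "nat \<Rightarrow> nat \<Rightarrow> nat \<Rightarrow> int set" where
  "blocks a b j = (\<Union>i<j. block a b i)"

lemma finite_block: "finite (block a b i)"
  and card_block: "card (block a b i) = b"
  by (simp_all add: block_def)

lemma finite_blocks: "finite (blocks a b j)"
  by (simp add: blocks_def finite_block)

lemma blocks_0: "blocks a b 0 = {}"
  and blocks_Suc: "blocks a b (Suc j) = blocks a b j \<union> block a b j"
  by (auto simp: blocks_def lessThan_Suc)

lemma blocks_subset:
  assumes "b \<le> a"
  shows "blocks a b j \<subseteq> {1..int (j * a)}"
proof
  fix t assume "t \<in> blocks a b j"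
  then obtain i where i: "i < j" "t \<in> block a b i" by (auto simp: blocks_def)
  have "i * a + a \<le> j * a"
    using mult_le_mono1[of "Suc i" j a] i by simp
  then have "int (i * a) + int b \<le> int (j * a)" using assms by linarith
  moreover have "0 \<le> int (i * a)" by simp
  ultimately show "t \<in> {1..int (j * a)}" using i unfolding block_def atLeastAtMost_iff by linarith
qed

lemma blocks_block_disjoint:
  assumes "b \<le> a"
  shows "blocks a b j \<inter> block a b j = {}"
  using blocks_subset[OF assms, of j] by (auto simp: block_def)

lemma card_blocks:
  assumes "b \<le> a"
  shows "card (blocks a b j) = j * b"
  by (induction j)
    (simp_all add: blocks_0 blocks_Suc card_Un_disjoint finite_blocks finite_block card_block
      blocks_block_disjoint[OF assms])

lemma Max_blocks:
  assumes "b \<le> a" "b > 0"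
  shows "Max (blocks a b (Suc j)) = int (j * a) + int b"
proof (rule Max_eqI)
  fix t assume "t \<in> blocks a b (Suc j)"
  then show "t \<le> int (j * a) + int b"
    using blocks_subset[OF assms(1), of j] by (auto simp: blocks_Suc block_def)
qed (use assms in \<open>auto simp: finite_blocks blocks_Suc block_def\<close>)

lemma Min_block: "b > 0 \<Longrightarrow> Min (block a b j) = int (j * a) + 1"
  unfolding block_def by (intro Min_eqI) auto

context stationary_sequence
begin

lemma prob_below_block: "prob_below (block a b j) w = prob_below {1..int b} w"
proof -
  have "block a b j = (\<lambda>t. t + int (j * a)) ` {1..int b}"
    by (simp add: block_def image_add_atLeastAtMost' add.commute)
  then show ?thesis by (simp only: prob_below_shift finite_atLeastAtMost_int)
qed

text \<open>
  One block is split off at a time, and each time the error \<open>E\<close> is added: multiplying the earlier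
  error by a probability does not increase it.
\<close>

lemma prob_below_blocks:
  assumes step: "\<And>j. Suc j < k \<Longrightarrow>
    \<bar>prob_below (blocks a b (Suc (Suc j))) w
      - prob_below (blocks a b (Suc j)) w * prob_below {1..int b} w\<bar> \<le> E"
    and "E \<ge> 0"
  shows "\<bar>prob_below (blocks a b k) w - prob_below {1..int b} w ^ k\<bar> \<le> k * E"
proof -
  let ?P = "\<lambda>j. prob_below (blocks a b j) w" and ?q = "prob_below {1..int b} w"
  have "\<bar>?P j - ?q ^ j\<bar> \<le> j * E" if "j \<le> k" for j
    using that
  proof (induction j)
    case 0
    then show ?case by (simp add: blocks_0 prob_below_empty)
  next
    case (Suc j)
    have one: "\<bar>?P (Suc j) - ?P j * ?q\<bar> \<le> E"
    proof (cases j)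
      case 0
      then show ?thesis using assms(2)
        by (simp add: blocks_Suc blocks_0 prob_below_empty prob_below_block)
    next
      case (Suc i)
      then show ?thesis using step[of i] Suc.prems \<open>Suc j \<le> k\<close> by simp
    qed
    have "?P (Suc j) - ?q ^ Suc j = (?P (Suc j) - ?P j * ?q) + (?P j - ?q ^ j) * ?q"
      by (simp add: algebra_simps)
    then have "\<bar>?P (Suc j) - ?q ^ Suc j\<bar> \<le> \<bar>?P (Suc j) - ?P j * ?q\<bar> + \<bar>?P j - ?q ^ j\<bar> * ?q"
      by (metis abs_mult abs_of_nonneg abs_triangle_ineq prob_below_nonneg)
    also have "\<bar>?P j - ?q ^ j\<bar> * ?q \<le> \<bar>?P j - ?q ^ j\<bar> * 1"
      using prob_below_le_1 by (intro mult_left_mono) auto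
    also have "\<bar>?P j - ?q ^ j\<bar> \<le> j * E" using Suc by simp
    finally show ?case using one by (simp add: algebra_simps)
  qed
  then show ?thesis by simp
qed

text \<open>
  The first summand of the bound is the total cost of treating \<open>k\<close> blocks as independent. The
  second one accounts for indices left out: at most \<open>l\<close> per block and an incomplete block at the
  end in comparing the blocks with all of \<open>{1..n}\<close>, and again \<open>l\<close> per block when the shortened block
  length is replaced by \<open>a\<close>.
\<close>

lemma block_approximation:
  fixes n a l :: nat
  defines "k \<equiv> n div a"
  assumes l: "0 < l" "l \<le> a" and e: "e > 0" and D: "D \<ge> 0"
    and cov: "\<And>I J. finite I \<Longrightarrow> I \<noteq> {} \<Longrightarrow> finite J \<Longrightarrow> J \<noteq> {} \<Longrightarrow> int l = Min J - Max I \<Longrightarrow>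
      card I + card J \<le> n \<Longrightarrow> card J \<le> a \<Longrightarrow>
      \<bar>covariance M (smooth_below X I w e) (smooth_below X J w e)\<bar> \<le> D"
  shows "\<bar>prob_below {1..int n} w - prob_below {1..int a} w ^ k\<bar>
    \<le> k * (D + 2 * n * (marginal_cdf (w + e) - marginal_cdf w))
      + (a + 2 * k * l) * (1 - marginal_cdf w)"
proof -
  \<comment> \<open>With this length the last index of a block and the first index of the next are exactly \<open>l\<close> apart.\<close>
  define b where "b = a + 1 - l"
  have b: "b \<le> a" "0 < b" and bl: "b + l = a + 1" using l by (auto simp: b_def)
  let ?T = "1 - marginal_cdf w" and ?d = "marginal_cdf (w + e) - marginal_cdf w"
  let ?E = "D + 2 * n * ?d"
  have T: "?T \<ge> 0" using marginal_cdf_le_1 by simp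
  have d: "?d \<ge> 0" using marginal_cdf_mono[of w "w + e"] e by simp
  have kb: "k * b \<le> k * a" "k * a \<le> n" using b by (auto simp: k_def)

  have 1: "\<bar>prob_below (blocks a b k) w - prob_below {1..int b} w ^ k\<bar> \<le> k * ?E"
  proof (rule prob_below_blocks)
    fix j assume j: "Suc j < k"
    let ?I = "blocks a b (Suc j)" and ?J = "block a b (Suc j)"
    have ne: "?I \<noteq> {}" "?J \<noteq> {}" using b by (auto simp: blocks_Suc block_def)
    have "card ?I + card ?J = Suc (Suc j) * b" using b by (simp add: card_blocks card_block)
    also have "\<dots> \<le> k * b" using j by (intro mult_le_mono1) simp
    finally have card: "card ?I + card ?J \<le> n" using kb by linarith
    have gap: "int l = Min ?J - Max ?I"
      using b bl by (simp add: Max_blocks Min_block algebra_simps)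
    have "\<bar>prob_below (?I \<union> ?J) w - prob_below ?I w * prob_below ?J w\<bar>
        \<le> D + 2 * (card ?I + card ?J) * ?d"
      using ne gap card b e
      by (intro quasi_independence cov) (auto simp: finite_blocks finite_block card_block)
    also have "\<dots> \<le> ?E"
    proof -
      have "real (2 * (card ?I + card ?J)) \<le> real (2 * n)"
        by (intro of_nat_mono mult_le_mono2 card)
      then show ?thesis using mult_right_mono[OF _ d] by fastforce
    qed
    finally show "\<bar>prob_below (blocks a b (Suc (Suc j))) w
        - prob_below ?I w * prob_below {1..int b} w\<bar> \<le> ?E"
      by (simp add: blocks_Suc[of a b "Suc j"] prob_below_block)
  qed (use D d in simp)

  have 2: "\<bar>prob_below {1..int b} w ^ k - prob_below {1..int a} w ^ k\<bar> \<le> k * (l * ?T)"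
  proof -
    have "card ({1..int a} - {1..int b}) \<le> l"
    proof -
      have "{1..int a} - {1..int b} = {int b + 1..int a}" by auto
      then show ?thesis using bl by simp
    qed
    then have "card ({1..int a} - {1..int b}) * ?T \<le> l * ?T"
      using T by (intro mult_right_mono) auto
    then have "\<bar>prob_below {1..int b} w - prob_below {1..int a} w\<bar> \<le> l * ?T"
      using prob_below_subset_diff_le[of "{1..int a}" "{1..int b}" w]
        prob_below_antimono[of "{1..int a}" "{1..int b}" w] b by simp
    moreover have "\<bar>prob_below {1..int b} w ^ k - prob_below {1..int a} w ^ k\<bar>
        \<le> k * \<bar>prob_below {1..int b} w - prob_below {1..int a} w\<bar>"
      using norm_power_diff[of "prob_below {1..int b} w" "prob_below {1..int a} w" k]
        prob_below_nonneg prob_below_le_1 by simp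
    ultimately show ?thesis by (meson mult_left_mono of_nat_0_le_iff order_trans)
  qed

  have 3: "\<bar>prob_below (blocks a b k) w - prob_below {1..int n} w\<bar> \<le> (a + k * l) * ?T"
  proof -
    have "int (k * a) \<le> int n" using kb(2) by (rule of_nat_mono)
    then have sub: "blocks a b k \<subseteq> {1..int n}" using blocks_subset[OF b(1), of k] by auto
    have "card ({1..int n} - blocks a b k) = n - k * b"
      using sub b by (simp add: card_Diff_subset finite_blocks card_blocks)
    also have "\<dots> \<le> a + k * l"
    proof -
      have "n = k * a + n mod a" by (simp add: k_def)
      moreover have "n mod a < a" using l by simp
      moreover have "k * a \<le> k * b + k * l"
        unfolding distrib_left[symmetric] using bl by (intro mult_le_mono2) simp
      ultimately show ?thesis by linarith
    qed
    finally have "card ({1..int n} - blocks a b k) * ?T \<le> (a + k * l) * ?T"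
      using T by (intro mult_right_mono) (simp_all only: of_nat_le_iff)
    then show ?thesis
      using prob_below_subset_diff_le[OF _ sub, of w] prob_below_antimono[OF _ sub, of w] by simp
  qed

  have "(a + 2 * k * l) * ?T = (a + k * l) * ?T + k * (l * ?T)"
    by (simp add: algebra_simps)
  then show ?thesis using 1 2 3 by linarith
qed

end

section \<open>Limits of powers and of monotone functions\<close>

lemma tendsto_one_minus_power:
  fixes p :: "nat \<Rightarrow> real" and k :: "nat \<Rightarrow> nat"
  assumes p: "\<And>n. 0 \<le> p n" and k: "filterlim k at_top sequentially"
    and lim: "(\<lambda>n. k n * p n) \<longlonglongrightarrow> c"
  shows "(\<lambda>n. (1 - p n) ^ k n) \<longlonglongrightarrow> exp (- c)"
proof -
  have rk: "filterlim (\<lambda>n. real (k n)) at_top sequentially"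
    using k by (rule filterlim_compose[OF filterlim_real_sequentially])
  have k_pos: "\<forall>\<^sub>F n in sequentially. k n > 0"
    using k[unfolded filterlim_at_top, rule_format, of 1] by (auto elim: eventually_mono)
  have "(\<lambda>n. k n * p n / k n) \<longlonglongrightarrow> 0"
    by (rule real_tendsto_divide_at_top[OF lim rk])
  then have p0: "p \<longlonglongrightarrow> 0"
    by (rule Lim_transform_eventually) (use k_pos in \<open>auto elim: eventually_mono\<close>)
  then have p1: "\<forall>\<^sub>F n in sequentially. p n < 1"
    by (rule order_tendstoD) simp
  show ?thesis
  proof (rule tendsto_sandwich)
    show "\<forall>\<^sub>F n in sequentially. (1 - p n) ^ k n \<le> exp (- (k n * p n))"
      using p1
    proof eventually_elim
      case (elim n)
      have "(1 - p n) ^ k n \<le> exp (- p n) ^ k n"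
        using elim exp_ge_add_one_self[of "- p n"] by (intro power_mono) auto
      then show ?case by (simp add: exp_of_nat_mult [symmetric])
    qed
    show "\<forall>\<^sub>F n in sequentially. exp (- (k n * p n / (1 - p n))) \<le> (1 - p n) ^ k n"
      using p1
    proof eventually_elim
      case (elim n)
      have "1 / (1 - p n) \<le> exp (p n / (1 - p n))"
        using elim exp_ge_add_one_self[of "p n / (1 - p n)"] by (simp add: field_simps)
      then have "exp (- (p n / (1 - p n))) \<le> 1 - p n"
        using elim by (simp add: exp_minus field_simps)
      then have "exp (- (p n / (1 - p n))) ^ k n \<le> (1 - p n) ^ k n"
        by (intro power_mono) auto
      then show ?case by (simp add: exp_of_nat_mult [symmetric])
    qed
    show "(\<lambda>n. exp (- (k n * p n))) \<longlonglongrightarrow> exp (- c)"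
      using lim by (intro tendsto_intros)
    have "(\<lambda>n. exp (- (k n * p n / (1 - p n)))) \<longlonglongrightarrow> exp (- (c / (1 - 0)))"
      using lim p0 by (intro tendsto_intros) auto
    then show "(\<lambda>n. exp (- (k n * p n / (1 - p n)))) \<longlonglongrightarrow> exp (- c)" by simp
  qed
qed

text \<open>
  Since $f_n \to 1$, the quantities $1 - f_n$ and $-\ln f_n$ are asymptotically equivalent:
  $f_n (-\ln f_n) \le 1 - f_n \le -\ln f_n$.
\<close>

lemma tendsto_mult_one_minus_of_power:
  fixes f :: "nat \<Rightarrow> real"
  assumes f: "\<And>n. 0 \<le> f n" "\<And>n. f n \<le> 1" and lim: "(\<lambda>n. f n ^ n) \<longlonglongrightarrow> exp (- \<tau>)"
  shows "(\<lambda>n. n * (1 - f n)) \<longlonglongrightarrow> \<tau>"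
proof -
  have "\<forall>\<^sub>F n in sequentially. f n ^ n > 0"
    using lim by (rule order_tendstoD) simp
  then have pos: "\<forall>\<^sub>F n in sequentially. f n > 0"
    using eventually_gt_at_top[of 0]
  proof eventually_elim
    case (elim n)
    then show ?case using f(1)[of n] by (cases "f n = 0") (auto simp: power_0_left)
  qed
  have "(\<lambda>n. - ln (f n ^ n)) \<longlonglongrightarrow> - ln (exp (- \<tau>))"
    using lim by (intro tendsto_intros) auto
  then have L: "(\<lambda>n. n * - ln (f n)) \<longlonglongrightarrow> \<tau>"
    using Lim_transform_eventually[where f = "\<lambda>n. - ln (f n ^ n)" and g = "\<lambda>n. n * - ln (f n)"]
      eventually_mono[OF pos] by (simp add: ln_realpow)
  have "(\<lambda>n. n * - ln (f n) / real n) \<longlonglongrightarrow> 0"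
    by (rule real_tendsto_divide_at_top[OF L filterlim_real_sequentially])
  then have "(\<lambda>n. exp (- (n * - ln (f n) / real n))) \<longlonglongrightarrow> exp (- 0)"
    by (intro tendsto_intros)
  moreover have "\<forall>\<^sub>F n in sequentially. exp (- (n * - ln (f n) / real n)) = f n"
    using pos eventually_gt_at_top[of 0] by eventually_elim simp
  ultimately have f1: "f \<longlonglongrightarrow> 1" by (simp add: Lim_transform_eventually)
  show ?thesis
  proof (rule tendsto_sandwich)
    show "\<forall>\<^sub>F n in sequentially. n * (1 - f n) \<le> n * - ln (f n)"
      using pos
    proof eventually_elim
      case (elim n)
      then show ?case using ln_le_minus_one[of "f n"] by (intro mult_left_mono) auto
    qed
    show "\<forall>\<^sub>F n in sequentially. f n * (n * - ln (f n)) \<le> n * (1 - f n)"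
      using pos
    proof eventually_elim
      case (elim n)
      have "- ln (f n) \<le> 1 / f n - 1"
        using elim ln_le_minus_one[of "1 / f n"] by (simp add: ln_div)
      then have "f n * - ln (f n) \<le> 1 - f n" using elim by (simp add: field_simps)
      then have "n * (f n * - ln (f n)) \<le> n * (1 - f n)" by (intro mult_left_mono) auto
      then show ?case by (simp add: mult.left_commute)
    qed
    show "(\<lambda>n. f n * (n * - ln (f n))) \<longlonglongrightarrow> \<tau>"
      using tendsto_mult[OF f1 L] by simp
  qed (rule L)
qed

text \<open>
  At least half of \<open>(x' - x) / e\<close> disjoint windows of length \<open>e\<close> fit into the interval, and the
  increments of \<open>h\<close> over them add up to at most \<open>C\<close>.
\<close>

lemma pigeonhole_increment:
  fixes h :: "real \<Rightarrow> real"
  assumes mono: "mono h" and e: "0 < e" "e \<le> x' - x" and C: "h x' - h x \<le> C"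
  shows "\<exists>y. x \<le> y \<and> y \<le> x' \<and> h (y + e) - h y \<le> 2 * C * e / (x' - x)"
proof -
  let ?L = "x' - x"
  define m where "m = nat \<lfloor>?L / e\<rfloor>"
  have ge1: "1 \<le> ?L / e" using e by (simp add: field_simps)
  then have m1: "1 \<le> m" by (simp add: m_def le_nat_iff)
  have m_le: "m \<le> ?L / e" unfolding m_def using ge1 by simp
  have m_ge: "?L / e \<le> 2 * m" 
  proof -
    have "?L / e < real_of_int \<lfloor>?L / e\<rfloor> + 1" by linarith
    moreover have "real m = real_of_int \<lfloor>?L / e\<rfloor>" using ge1 by (simp add: m_def)
    ultimately show ?thesis using m1 by linarith
  qed
  have me: "m * e \<le> ?L" using m_le e by (simp add: field_simps)
  have "C \<ge> 0" using monoD[OF mono, of x x'] C e by simp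
  have tel: "(\<Sum>i<m. h (x + real (Suc i) * e) - h (x + real i * e)) = h (x + m * e) - h x"
    using sum_lessThan_telescope[of "\<lambda>i. h (x + real i * e)" m] by simp
  have sum: "(\<Sum>i<m. h (x + real (Suc i) * e) - h (x + real i * e)) \<le> C"
    unfolding tel using monoD[OF mono, of "x + m * e" x'] me C by simp
  have "\<exists>i<m. h (x + real (Suc i) * e) - h (x + real i * e) \<le> C / m"
  proof (rule ccontr)
    assume "\<not> ?thesis"
    then have "(\<Sum>i<m. C / m) < (\<Sum>i<m. h (x + real (Suc i) * e) - h (x + real i * e))"
      using m1 by (intro sum_strict_mono) (auto simp: not_le lessThan_empty_iff)
    then show False using sum m1 by simp
  qed
  then obtain i where i: "i < m" "h (x + real (Suc i) * e) - h (x + real i * e) \<le> C / m" by blast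
  have "real i * e \<le> m * e" using i e by (intro mult_right_mono) auto
  then have "x + real i * e \<le> x'" using me by simp
  moreover have "C / m \<le> 2 * C * e / ?L"
  proof -
    have "?L \<le> 2 * m * e" using m_ge e by (simp add: field_simps)
    then have "C * ?L \<le> C * (2 * m * e)" using \<open>C \<ge> 0\<close> by (rule mult_left_mono)
    then show ?thesis using m1 e by (simp add: field_simps)
  qed
  moreover have "x + real (Suc i) * e = x + real i * e + e" by (simp add: algebra_simps)
  ultimately have "h (x + real i * e + e) - h (x + real i * e) \<le> 2 * C * e / ?L"
    using i(2) by (metis order_trans)
  moreover have "x \<le> x + real i * e" using e by simp
  ultimately show ?thesis using \<open>x + real i * e \<le> x'\<close> by blast
qed

text \<open>
  The levels at which \<open>A n\<close> and \<open>Q n\<close> are close may move with \<open>n\<close>. Catching one of them just above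
  and one just below \<open>x\<close>, monotonicity gives
  \<open>Q n (x - \<delta>) - \<epsilon> \<le> A n x \<le> Q n (x + \<delta>) + \<epsilon>\<close>.
\<close>

lemma tendsto_of_close_mono:
  fixes A Q :: "nat \<Rightarrow> real \<Rightarrow> real" and q :: "real \<Rightarrow> real"
  assumes mono: "\<And>n. mono (A n)" "\<And>n. mono (Q n)"
    and S: "open S" "x \<in> S" and cont: "isCont q x"
    and Q: "\<And>z. z \<in> S \<Longrightarrow> (\<lambda>n. Q n z) \<longlonglongrightarrow> q z"
    and close: "\<And>y y' e. y \<in> S \<Longrightarrow> y' \<in> S \<Longrightarrow> y < y' \<Longrightarrow> e > 0 \<Longrightarrow>
      \<forall>\<^sub>F n in sequentially. \<exists>z. y \<le> z \<and> z \<le> y' \<and> \<bar>A n z - Q n z\<bar> < e"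
  shows "(\<lambda>n. A n x) \<longlonglongrightarrow> q x"
proof (rule tendstoI)
  fix e :: real assume "e > 0"
  then have e3: "e / 3 > 0" by simp
  obtain d1 where d1: "d1 > 0" "ball x d1 \<subseteq> S" using S by (meson open_contains_ball)
  obtain d2 where d2: "d2 > 0" "\<And>z. dist z x < d2 \<Longrightarrow> dist (q z) (q x) < e / 3"
    using cont e3 unfolding continuous_at_eps_delta by blast
  define d where "d = min d1 d2 / 2"
  have d: "d > 0" "d < d1" "d < d2" using d1 d2 by (auto simp: d_def)
  let ?y = "x - d" and ?z = "x + d"
  have S': "?y \<in> S" "?z \<in> S" using d d1 by (auto simp: subset_iff dist_real_def)
  have q: "\<bar>q ?y - q x\<bar> < e / 3" "\<bar>q ?z - q x\<bar> < e / 3"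
    using d2(2)[of ?y] d2(2)[of ?z] d by (auto simp: dist_real_def)
  have "\<forall>\<^sub>F n in sequentially. \<bar>Q n ?y - q ?y\<bar> < e / 3" "\<forall>\<^sub>F n in sequentially. \<bar>Q n ?z - q ?z\<bar> < e / 3"
    using tendstoD[OF Q[OF S'(1)] e3] tendstoD[OF Q[OF S'(2)] e3] by (simp_all add: dist_real_def)
  moreover have "\<forall>\<^sub>F n in sequentially. \<exists>z. ?y \<le> z \<and> z \<le> x \<and> \<bar>A n z - Q n z\<bar> < e / 3"
    "\<forall>\<^sub>F n in sequentially. \<exists>z. x \<le> z \<and> z \<le> ?z \<and> \<bar>A n z - Q n z\<bar> < e / 3"
    using close[OF S'(1) S(2) _ e3] close[OF S(2) S'(2) _ e3] d by simp_all
  ultimately show "\<forall>\<^sub>F n in sequentially. dist (A n x) (q x) < e"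
  proof eventually_elim
    case (elim n)
    then obtain s t where s: "?y \<le> s" "s \<le> x" "\<bar>A n s - Q n s\<bar> < e / 3"
      and t: "x \<le> t" "t \<le> ?z" "\<bar>A n t - Q n t\<bar> < e / 3" by blast
    have "A n s \<le> A n x" "A n x \<le> A n t" "Q n ?y \<le> Q n s" "Q n t \<le> Q n ?z"
      using s t mono[of n] by (auto dest: monoD)
    then show ?case using elim s t q unfolding dist_real_def by linarith
  qed
qed

section \<open>The smoothing scale\<close>

lemma ennroot_ennreal: "0 \<le> x \<Longrightarrow> ennroot k (ennreal x) = ennreal (root k x)"
  by (simp add: ennroot_def)

lemma ennroot_less_top_iff: "ennroot k x < top \<longleftrightarrow> x < top"
  by (simp add: ennroot_def less_top)

lemma ennreal_mult_less_topD:
  assumes "ennreal r * x < top" "r > 0"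
  shows "x < top"
  using assms by (auto simp: less_top[symmetric] ennreal_mult_eq_top_iff)

text \<open>
  With \<open>c\<close> the dependence coefficient and ramps of width \<open>e / u\<close>, the part of the covariance bound
  that is linear in the Lipschitz constant is \<open>n c u / e\<close>. It is at most \<open>e\<close> as soon as
  \<open>n c u \<le> e\<^sup>2\<close>.
\<close>

lemma covariance_scale_sum:
  fixes c n e u N :: real
  assumes "c \<ge> 0" "u > 0" "e > 0" "N \<le> n" "sqrt (n * c * u) \<le> e" "n \<ge> 0"
  shows "c * (N / (e / u)) \<le> e"
proof -
  have "n * c * u = (sqrt (n * c * u))\<^sup>2" using assms by simp
  also have "\<dots> \<le> e\<^sup>2" using assms by (intro power_mono) auto
  finally have "c * n * u \<le> e * e" by (simp add: power2_eq_square mult_ac)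
  moreover have "c * N * u \<le> c * n * u" using assms by (intro mult_right_mono mult_left_mono) auto
  ultimately show ?thesis using assms by (simp add: field_simps)
qed

text \<open>
  The part that contains the product of the Lipschitz constants is \<open>n a c u\<^sup>2 / e\<^sup>2\<close>, which is at most \<open>e\<close>
  as soon as \<open>n a c u\<^sup>2 \<le> e\<^sup>3\<close>. This is the origin of the cube root.
\<close>

lemma covariance_scale_prod:
  fixes c n e u N a K :: real
  assumes "c \<ge> 0" "u > 0" "e > 0" "0 \<le> N" "N \<le> n" "0 \<le> K" "K \<le> a"
    and "root 3 (n * a * c * u\<^sup>2) \<le> e"
  shows "c * (N * K / (e / u)\<^sup>2) \<le> e"
proof -
  have "n * a * c * u\<^sup>2 = (root 3 (n * a * c * u\<^sup>2)) ^ 3"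
    using assms by simp
  also have "\<dots> \<le> e ^ 3" using assms by (intro power_mono) auto
  finally have "(c * u\<^sup>2) * (n * a) \<le> e * e\<^sup>2" by (simp add: power2_eq_square power3_eq_cube mult_ac)
  moreover have "(c * u\<^sup>2) * (N * K) \<le> (c * u\<^sup>2) * (n * a)"
    using assms by (intro mult_left_mono mult_mono) auto
  ultimately have "c * u\<^sup>2 * (N * K) / e\<^sup>2 \<le> e" using assms by (simp add: pos_divide_le_eq)
  then show ?thesis by (simp add: power_divide mult_ac)
qed

text \<open>
  The dependence coefficient may vanish, but the width of a ramp must be positive. The extra term
  \<open>a n / (n + 1)\<^sup>2\<close> ensures this, and after multiplication by \<open>n / a n\<close> it still vanishes.
\<close>

lemma tendsto_smoothing_scale:
  fixes a :: "nat \<Rightarrow> nat" and \<rho> :: "nat \<Rightarrow> real"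
  assumes a: "\<And>n. a n > 0" and \<rho>: "\<And>n. \<rho> n \<ge> 0"
    and R: "(\<lambda>n. ennreal (real n / real (a n)) * R n) \<longlonglongrightarrow> 0"
    and eq: "\<forall>\<^sub>F n in sequentially. R n = ennreal (\<rho> n)"
  shows "(\<lambda>n. n / a n * (\<rho> n + a n / (real (Suc n))\<^sup>2)) \<longlonglongrightarrow> 0"
proof -
  have "(\<lambda>n. ennreal (n / a n * \<rho> n)) \<longlonglongrightarrow> 0"
    by (rule Lim_transform_eventually[OF R])
      (use eq \<rho> in \<open>auto elim!: eventually_mono simp flip: ennreal_mult\<close>)
  then have "(\<lambda>n. n / a n * \<rho> n) \<longlonglongrightarrow> 0"
    using \<rho> by (subst (asm) tendsto_ennreal_iff[where x = 0, simplified]) auto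
  moreover have "(\<lambda>n. real n / (real (Suc n))\<^sup>2) \<longlonglongrightarrow> 0"
    by real_asymp
  ultimately have "(\<lambda>n. n / a n * \<rho> n + real n / (real (Suc n))\<^sup>2) \<longlonglongrightarrow> 0 + 0"
    by (rule tendsto_add)
  moreover have "n / a n * \<rho> n + real n / (real (Suc n))\<^sup>2 = n / a n * (\<rho> n + a n / (real (Suc n))\<^sup>2)" for n
    using a[of n] by (simp add: distrib_left)
  ultimately show ?thesis by simp
qed

text \<open>
  All that the block argument uses of weak dependence: a width \<open>e n\<close>, measured on the scale of the
  normalized levels, so small that \<open>n / a n\<close> errors of size \<open>e n\<close> are negligible, and so large that
  the ramps of this width on index sets at distance \<open>l n\<close> have covariance at most \<open>2 * e n\<close>. The
  bounds on the cardinalities are those of the blocks inside \<open>{1..n}\<close>.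
\<close>

definition smoothing_scale ::
  "'a measure \<Rightarrow> (int \<Rightarrow> 'a \<Rightarrow> real) \<Rightarrow> (nat \<Rightarrow> real) \<Rightarrow> (nat \<Rightarrow> nat) \<Rightarrow> (nat \<Rightarrow> nat) \<Rightarrow> (nat \<Rightarrow> real) \<Rightarrow> bool" where
  "smoothing_scale M X u a l e \<longleftrightarrow>
     (\<forall>n. e n > 0) \<and> (\<lambda>n. n / a n * e n) \<longlonglongrightarrow> 0 \<and>
     (\<forall>\<^sub>F n in sequentially. \<forall>w I J. finite I \<longrightarrow> I \<noteq> {} \<longrightarrow> finite J \<longrightarrow> J \<noteq> {} \<longrightarrow>
        int (l n) = Min J - Max I \<longrightarrow> card I + card J \<le> n \<longrightarrow> card J \<le> a n \<longrightarrow>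
        \<bar>covariance M (smooth_below X I w (e n / u n)) (smooth_below X J w (e n / u n))\<bar> \<le> 2 * e n)"

lemma eta_smoothing_scale:
  assumes u: "\<And>n. u n > 0" and a: "\<And>n. a n > 0"
    and lim: "(\<lambda>n. ennreal (real n / real (a n)) *
      ennroot 2 (ennreal (real n) * eta_coeff M X (l n) * ennreal (u n))) \<longlonglongrightarrow> 0"
  shows "\<exists>e. smoothing_scale M X u a l e"
proof -
  define c where "c n = enn2real (eta_coeff M X (l n))" for n
  define e where "e n = sqrt (n * c n * u n) + a n / (real (Suc n))\<^sup>2" for n
  have c: "c n \<ge> 0" for n by (simp add: c_def)
  have e: "e n > 0" "sqrt (n * c n * u n) \<le> e n" for n
    using a[of n] u[of n] c[of n] by (auto simp: e_def intro!: add_nonneg_pos)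
  have "\<forall>\<^sub>F n in sequentially. ennreal (real n / real (a n)) *
      ennroot 2 (ennreal (real n) * eta_coeff M X (l n) * ennreal (u n)) < top"
    using lim by (rule order_tendstoD) simp
  then have coeff: "\<forall>\<^sub>F n in sequentially. eta_coeff M X (l n) = ennreal (c n)"
    using eventually_gt_at_top[of 0]
  proof eventually_elim
    case (elim n)
    then have "ennreal (real n) * eta_coeff M X (l n) * ennreal (u n) < top"
      using a[of n] ennroot_less_top_iff ennreal_mult_less_topD
      by (metis divide_pos_pos of_nat_0_less_iff)
    then have "ennreal (real n) * eta_coeff M X (l n) < top"
      using u[of n] by (metis ennreal_mult_less_topD mult.commute)
    then have "eta_coeff M X (l n) < top"
      using elim by (metis ennreal_mult_less_topD of_nat_0_less_iff)
    then show ?case by (simp add: c_def)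
  qed
  have "(\<lambda>n. n / a n * e n) \<longlonglongrightarrow> 0"
    unfolding e_def
  proof (rule tendsto_smoothing_scale[OF a _ lim])
    show "\<forall>\<^sub>F n in sequentially. ennroot 2 (ennreal (real n) * eta_coeff M X (l n) * ennreal (u n))
        = ennreal (sqrt (n * c n * u n))"
      using coeff
    proof eventually_elim
      case (elim n)
      then show ?case using c[of n] u[of n]
        by (simp add: ennreal_mult[symmetric] ennroot_ennreal sqrt_def)
    qed
  qed (use c u in \<open>simp add: less_imp_le\<close>)
  moreover have "\<forall>\<^sub>F n in sequentially. \<forall>w I J. finite I \<longrightarrow> I \<noteq> {} \<longrightarrow> finite J \<longrightarrow> J \<noteq> {} \<longrightarrow>
        int (l n) = Min J - Max I \<longrightarrow> card I + card J \<le> n \<longrightarrow> card J \<le> a n \<longrightarrow>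
        \<bar>covariance M (smooth_below X I w (e n / u n)) (smooth_below X J w (e n / u n))\<bar> \<le> 2 * e n"
    using coeff
  proof (eventually_elim, intro allI impI)
    fix n w and I J :: "int set"
    assume coeff: "eta_coeff M X (l n) = ennreal (c n)"
      and I: "finite I" "I \<noteq> {}" and J: "finite J" "J \<noteq> {}" and gap: "int (l n) = Min J - Max I"
      and card: "card I + card J \<le> n" "card J \<le> a n"
    have "\<bar>covariance M (smooth_below X I w (e n / u n)) (smooth_below X J w (e n / u n))\<bar>
        \<le> c n * (real (card I + card J) / (e n / u n))"
      using e[of n] u[of n] by (intro covariance_eta_le[OF I J gap _ coeff c]) simp
    also have "\<dots> \<le> e n"
      using e[of n] u[of n] of_nat_mono[OF card(1)] by (intro covariance_scale_sum[where n = n] c) auto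
    finally show "\<bar>covariance M (smooth_below X I w (e n / u n)) (smooth_below X J w (e n / u n))\<bar> \<le> 2 * e n"
      using e(1)[of n] by linarith
  qed
  ultimately show ?thesis using e unfolding smoothing_scale_def by blast
qed

lemma lambda_smoothing_scale:
  assumes u: "\<And>n. u n > 0" and a: "\<And>n. a n > 0"
    and lim: "(\<lambda>n. ennreal (real n / real (a n)) *
      max (ennroot 2 (ennreal (real n) * lambda_coeff M X (l n) * ennreal (u n)))
          (ennroot 3 (ennreal (real n) * ennreal (real (a n)) *
                       lambda_coeff M X (l n) * ennreal ((u n)\<^sup>2)))) \<longlonglongrightarrow> 0"
  shows "\<exists>e. smoothing_scale M X u a l e"
proof -
  define c where "c n = enn2real (lambda_coeff M X (l n))" for n
  define \<rho> where "\<rho> n = max (sqrt (n * c n * u n)) (root 3 (n * a n * c n * (u n)\<^sup>2))" for n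
  define e where "e n = \<rho> n + a n / (real (Suc n))\<^sup>2" for n
  have c: "c n \<ge> 0" for n by (simp add: c_def)
  have \<rho>: "\<rho> n \<ge> 0" for n
    using c[of n] u[of n] by (simp add: \<rho>_def le_max_iff_disj)
  have e_ge: "\<rho> n \<le> e n" for n by (simp add: e_def)
  have e: "e n > 0" "sqrt (n * c n * u n) \<le> e n" "root 3 (n * a n * c n * (u n)\<^sup>2) \<le> e n" for n
  proof -
    show "e n > 0" using a[of n] \<rho>[of n] by (auto simp: e_def intro!: add_nonneg_pos)
    show "sqrt (n * c n * u n) \<le> e n" "root 3 (n * a n * c n * (u n)\<^sup>2) \<le> e n"
      using e_ge[of n] by (simp_all add: \<rho>_def)
  qed
  have "\<forall>\<^sub>F n in sequentially. ennreal (real n / real (a n)) *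
      max (ennroot 2 (ennreal (real n) * lambda_coeff M X (l n) * ennreal (u n)))
          (ennroot 3 (ennreal (real n) * ennreal (real (a n)) *
                       lambda_coeff M X (l n) * ennreal ((u n)\<^sup>2))) < top"
    using lim by (rule order_tendstoD) simp
  then have coeff: "\<forall>\<^sub>F n in sequentially. lambda_coeff M X (l n) = ennreal (c n)"
    using eventually_gt_at_top[of 0]
  proof eventually_elim
    case (elim n)
    then have "ennreal (real n) * lambda_coeff M X (l n) * ennreal (u n) < top"
      using a[of n] ennroot_less_top_iff ennreal_mult_less_topD
      by (metis divide_pos_pos max_less_iff_conj of_nat_0_less_iff)
    then have "ennreal (real n) * lambda_coeff M X (l n) < top"
      using u[of n] by (metis ennreal_mult_less_topD mult.commute)
    then have "lambda_coeff M X (l n) < top"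
      using elim by (metis ennreal_mult_less_topD of_nat_0_less_iff)
    then show ?case by (simp add: c_def)
  qed
  have "(\<lambda>n. n / a n * e n) \<longlonglongrightarrow> 0"
    unfolding e_def
  proof (rule tendsto_smoothing_scale[OF a \<rho> lim])
    show "\<forall>\<^sub>F n in sequentially.
        max (ennroot 2 (ennreal (real n) * lambda_coeff M X (l n) * ennreal (u n)))
          (ennroot 3 (ennreal (real n) * ennreal (real (a n)) *
                       lambda_coeff M X (l n) * ennreal ((u n)\<^sup>2))) = ennreal (\<rho> n)"
      using coeff
    proof eventually_elim
      case (elim n)
      then show ?case using c[of n] u[of n]
        by (simp add: ennreal_mult[symmetric] ennroot_ennreal sqrt_def \<rho>_def
            max_of_mono[OF monoI[of ennreal, OF ennreal_leI]])
    qed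
  qed
  moreover have "\<forall>\<^sub>F n in sequentially. \<forall>w I J. finite I \<longrightarrow> I \<noteq> {} \<longrightarrow> finite J \<longrightarrow> J \<noteq> {} \<longrightarrow>
        int (l n) = Min J - Max I \<longrightarrow> card I + card J \<le> n \<longrightarrow> card J \<le> a n \<longrightarrow>
        \<bar>covariance M (smooth_below X I w (e n / u n)) (smooth_below X J w (e n / u n))\<bar> \<le> 2 * e n"
    using coeff
  proof (eventually_elim, intro allI impI)
    fix n w and I J :: "int set"
    assume coeff: "lambda_coeff M X (l n) = ennreal (c n)"
      and I: "finite I" "I \<noteq> {}" and J: "finite J" "J \<noteq> {}" and gap: "int (l n) = Min J - Max I"
      and card: "card I + card J \<le> n" "card J \<le> a n"
    have "\<bar>covariance M (smooth_below X I w (e n / u n)) (smooth_below X J w (e n / u n))\<bar>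
        \<le> c n * (real (card I + card J) / (e n / u n) + real (card I) * real (card J) / (e n / u n)\<^sup>2)"
      using e[of n] u[of n] by (intro covariance_lambda_le[OF I J gap _ coeff c]) simp
    also have "\<dots> = c n * (real (card I + card J) / (e n / u n))
        + c n * (real (card I) * real (card J) / (e n / u n)\<^sup>2)"
      by (rule distrib_left)
    also have "c n * (real (card I + card J) / (e n / u n)) \<le> e n"
      using e[of n] u[of n] of_nat_mono[OF card(1)] by (intro covariance_scale_sum[where n = n] c) auto
    also have "c n * (real (card I) * real (card J) / (e n / u n)\<^sup>2) \<le> e n"
      using e[of n] u[of n] card by (intro covariance_scale_prod[where n = n and a = "a n"] c) auto
    finally show "\<bar>covariance M (smooth_below X I w (e n / u n)) (smooth_below X J w (e n / u n))\<bar> \<le> 2 * e n"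
      by simp
  qed
  ultimately show ?thesis using e unfolding smoothing_scale_def by blast
qed

section \<open>The limit law of the maxima\<close>

context stationary_sequence
begin

text \<open>
  The theorem for any limiting tail \<open>\<tau>\<close>, on the open set of levels where it is known. With
  $k = \lfloor n / a_n \rfloor$ the power $P(M_{a_n} \le w_n)^k$ converges at every fixed level, while
  its distance to $P(M_n \le w_n)$ is shown to vanish only along suitable moving levels.
\<close>

lemma prob_below_limit:
  fixes a l :: "nat \<Rightarrow> nat" and u v e :: "nat \<Rightarrow> real" and \<tau> :: "real \<Rightarrow> real"
  defines "w \<equiv> norm_level u v"
  assumes u: "\<And>n. u n > 0" and a: "\<And>n. a n > 0" and l: "\<And>n. l n > 0"
    and a_n: "(\<lambda>n. real (a n) / real n) \<longlonglongrightarrow> 0"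
    and l_a: "(\<lambda>n. real (l n) / real (a n)) \<longlonglongrightarrow> 0"
    and scale: "smoothing_scale M X u a l e"
    and S: "open S" and \<tau>: "\<And>x. x \<in> S \<Longrightarrow> isCont \<tau> x"
    and tail: "\<And>x. x \<in> S \<Longrightarrow> (\<lambda>n. n * (1 - marginal_cdf (w n x))) \<longlonglongrightarrow> \<tau> x"
    and block_tail: "\<And>x. x \<in> S \<Longrightarrow>
      (\<lambda>n. n / a n * (1 - prob_below {1..int (a n)} (w n x))) \<longlonglongrightarrow> \<theta> * \<tau> x"
    and x: "x \<in> S"
  shows "(\<lambda>n. prob_below {1..int n} (w n x)) \<longlonglongrightarrow> exp (- (\<theta> * \<tau> x))"
proof -
  let ?A = "\<lambda>n x. prob_below {1..int n} (w n x)"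
  let ?k = "\<lambda>n. n div a n"
  let ?Q = "\<lambda>n x. prob_below {1..int (a n)} (w n x) ^ ?k n"
  let ?T = "\<lambda>n x. 1 - marginal_cdf (w n x)"
  have w_mono: "y \<le> z \<Longrightarrow> w n y \<le> w n z" for n y z
    using u[of n] by (simp add: w_def norm_level_def divide_right_mono)
  have w_add: "w n y + d / u n = w n (y + d)" for n y d
    by (simp add: w_def norm_level_def add_divide_distrib)
  have e: "\<And>n. e n > 0" and e_lim: "(\<lambda>n. n / a n * e n) \<longlonglongrightarrow> 0"
    and cov: "\<forall>\<^sub>F n in sequentially. \<forall>w I J. finite I \<longrightarrow> I \<noteq> {} \<longrightarrow> finite J \<longrightarrow> J \<noteq> {} \<longrightarrow>
        int (l n) = Min J - Max I \<longrightarrow> card I + card J \<le> n \<longrightarrow> card J \<le> a n \<longrightarrow>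
        \<bar>covariance M (smooth_below X I w (e n / u n)) (smooth_below X J w (e n / u n))\<bar> \<le> 2 * e n"
    using scale by (auto simp: smoothing_scale_def)
  have k_upper: "real (?k n) \<le> n / a n" for n
    by (rule of_nat_div_le_of_nat)
  have k_lower: "real n / a n - 1 \<le> real (?k n)" for n
  proof -
    have "real n = real (?k n) * a n + real (n mod a n)"
      by (simp flip: of_nat_mult of_nat_add)
    moreover have "real (n mod a n) \<le> real (a n)" using a[of n] by (simp add: less_imp_le)
    ultimately have "real n \<le> (real (?k n) + 1) * a n" by (simp add: algebra_simps)
    then show ?thesis using a[of n] by (simp add: field_simps)
  qed
  have a_le: "\<forall>\<^sub>F n in sequentially. a n \<le> n"
    using order_tendstoD(2)[OF a_n zero_less_one] eventually_gt_at_top[of 0]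
    by eventually_elim simp
  have l_le: "\<forall>\<^sub>F n in sequentially. l n \<le> a n"
    using order_tendstoD(2)[OF l_a zero_less_one] a by (auto elim!: eventually_mono)

  have n_a: "filterlim (\<lambda>n. real n / a n) at_top sequentially"
  proof -
    have "filterlim (\<lambda>n. inverse (real (a n) / real n)) at_top sequentially"
      using a_n by (rule filterlim_inverse_at_top)
        (use eventually_gt_at_top[of 0] in \<open>eventually_elim, use a in simp\<close>)
    then show ?thesis by simp
  qed
  have k_top: "filterlim ?k at_top sequentially"
  proof -
    have "filterlim (\<lambda>n. -1 + real n / a n) at_top sequentially"
      using n_a by (rule filterlim_tendsto_add_at_top[OF tendsto_const])
    then have "filterlim (\<lambda>n. real (?k n)) at_top sequentially"
      by (rule filterlim_at_top_mono) (use k_lower in \<open>simp add: algebra_simps\<close>)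
    then show ?thesis by (simp add: filterlim_sequentially_iff_filterlim_real)
  qed
  have k_ratio: "(\<lambda>n. real (?k n) * (a n / n)) \<longlonglongrightarrow> 1"
  proof (rule tendsto_sandwich)
    show "\<forall>\<^sub>F n in sequentially. 1 - a n / n \<le> real (?k n) * (a n / n)"
      using eventually_gt_at_top[of 0]
    proof eventually_elim
      case (elim n)
      have "(real n / a n - 1) * (a n / n) \<le> real (?k n) * (a n / n)"
        by (intro mult_right_mono k_lower) simp
      then show ?case using elim a[of n] by (simp add: left_diff_distrib diff_divide_distrib)
    qed
    show "\<forall>\<^sub>F n in sequentially. real (?k n) * (a n / n) \<le> 1"
      using eventually_gt_at_top[of 0]
    proof eventually_elim
      case (elim n)
      have "real (?k n) * (a n / n) \<le> (n / a n) * (a n / n)"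
        by (intro mult_right_mono k_upper) simp
      then show ?case using elim a[of n] by simp
    qed
    show "(\<lambda>n. 1 - a n / n) \<longlonglongrightarrow> 1"
      using tendsto_diff[OF tendsto_const a_n, of 1] by simp
  qed simp

  have Q: "(\<lambda>n. ?Q n z) \<longlonglongrightarrow> exp (- (\<theta> * \<tau> z))" if "z \<in> S" for z
  proof -
    have "(\<lambda>n. (real (?k n) * (a n / n)) * (n / a n * (1 - prob_below {1..int (a n)} (w n z))))
        \<longlonglongrightarrow> 1 * (\<theta> * \<tau> z)"
      by (intro tendsto_mult k_ratio block_tail that)
    moreover have "\<forall>\<^sub>F n in sequentially.
        (real (?k n) * (a n / n)) * (n / a n * (1 - prob_below {1..int (a n)} (w n z)))
        = ?k n * (1 - prob_below {1..int (a n)} (w n z))"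
      using eventually_gt_at_top[of 0] by eventually_elim (use a in simp)
    ultimately have "(\<lambda>n. ?k n * (1 - prob_below {1..int (a n)} (w n z))) \<longlonglongrightarrow> 1 * (\<theta> * \<tau> z)"
      by (rule Lim_transform_eventually)
    from tendsto_one_minus_power[OF _ k_top this] show ?thesis
      by (simp add: prob_below_le_1)
  qed

  have close: "\<forall>\<^sub>F n in sequentially. \<exists>z. y \<le> z \<and> z \<le> y' \<and> \<bar>?A n z - ?Q n z\<bar> < d"
    if y: "y \<in> S" "y' \<in> S" "y < y'" and d: "d > 0" for y y' d
  proof -
    \<comment> \<open>Bounds \<open>n (F (w n y') - F (w n y))\<close> for large \<open>n\<close>; the 1 makes the inequality strict in the limit.\<close>
    define C where "C = \<tau> y + 1"
    define L where "L = y' - y"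
    have L: "L > 0" using y by (simp add: L_def)
    let ?r = "\<lambda>n. (n / a n) * (2 * e n + 2 * (2 * C * e n / L)) + (a n / n + 2 * (l n / a n)) * C"
    have "?r = (\<lambda>n. (2 + 4 * C / L) * (n / a n * e n) + (a n / n + 2 * (l n / a n)) * C)"
      by (auto simp: algebra_simps)
    moreover have "\<dots> \<longlonglongrightarrow> (2 + 4 * C / L) * 0 + (0 + 2 * 0) * C"
      by (intro tendsto_intros e_lim a_n l_a)
    ultimately have r: "\<forall>\<^sub>F n in sequentially. ?r n < d"
      using d by (intro order_tendstoD(2)[of ?r 0]) simp_all
    have e_small: "\<forall>\<^sub>F n in sequentially. n / a n * e n < L"
      using e_lim L by (rule order_tendstoD(2))
    have TC: "\<forall>\<^sub>F n in sequentially. n * ?T n y < C"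
      using tail[OF y(1)] by (rule order_tendstoD(2)) (simp add: C_def)
    show ?thesis
      using r e_small TC cov a_le l_le eventually_gt_at_top[of 0]
    proof eventually_elim
      case (elim n)
      have "1 * e n \<le> n / a n * e n" using elim e[of n] a[of n] by (intro mult_right_mono) auto
      then have eL: "e n \<le> y' - y" using elim by (simp add: L_def)
      let ?h = "\<lambda>z. n * marginal_cdf (w n z)"
      have "mono ?h" by (intro monoI mult_left_mono marginal_cdf_mono w_mono) auto
      moreover have "?h y' - ?h y \<le> C"
      proof -
        have "?h y' \<le> real n * 1" by (intro mult_left_mono marginal_cdf_le_1) simp
        then have "?h y' - ?h y \<le> n * ?T n y" by (simp add: algebra_simps)
        then show ?thesis using elim by linarith
      qed
      ultimately obtain z where z: "y \<le> z" "z \<le> y'" "?h (z + e n) - ?h z \<le> 2 * C * e n / L"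
        using pigeonhole_increment[of ?h "e n" y' y C] e eL unfolding L_def by blast
      define \<Delta> where "\<Delta> = ?h (z + e n) - ?h z"
      have incr: "0 \<le> \<Delta>" "\<Delta> \<le> 2 * C * e n / L"
        using monoD[OF \<open>mono ?h\<close>, of z "z + e n"] e[of n] z(3) by (simp_all add: \<Delta>_def)
      have "\<bar>?A n z - ?Q n z\<bar>
          \<le> ?k n * (2 * e n + 2 * n * (marginal_cdf (w n z + e n / u n) - marginal_cdf (w n z)))
            + (a n + 2 * ?k n * l n) * ?T n z"
        using elim e[of n] u[of n] l[of n] by (intro block_approximation) auto
      also have "\<dots> = ?k n * (2 * e n + 2 * \<Delta>) + (a n + 2 * ?k n * l n) * ?T n z"
        by (simp add: \<Delta>_def w_add algebra_simps)
      also have "?k n * (2 * e n + 2 * \<Delta>)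
          \<le> (n / a n) * (2 * e n + 2 * (2 * C * e n / L))"
        using e[of n] incr(1) by (intro mult_mono k_upper add_left_mono mult_left_mono incr(2)) auto
      also have "(a n + 2 * ?k n * l n) * ?T n z \<le> (a n / n + 2 * (l n / a n)) * C"
      proof -
        have T: "0 \<le> ?T n z" "?T n z \<le> ?T n y"
          using marginal_cdf_le_1 marginal_cdf_mono[OF w_mono[OF z(1)]] by auto
        have "real (a n + 2 * ?k n * l n) \<le> a n + 2 * (n / a n) * l n"
          using mult_right_mono[OF k_upper[of n], of "2 * real (l n)"] by (simp add: algebra_simps)
        also have "\<dots> = (a n / n + 2 * (l n / a n)) * n"
          using elim by (simp add: distrib_right)
        finally have "(a n + 2 * ?k n * l n) * ?T n z \<le> (a n / n + 2 * (l n / a n)) * n * ?T n y"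
          using T by (intro mult_mono) auto
        also have "\<dots> = (a n / n + 2 * (l n / a n)) * (n * ?T n y)" by simp
        also have "\<dots> \<le> (a n / n + 2 * (l n / a n)) * C"
          using elim by (intro mult_left_mono) auto
        finally show ?thesis .
      qed
      finally have "\<bar>?A n z - ?Q n z\<bar> < d" using elim by simp
      then show ?case using z by blast
    qed
  qed

  show ?thesis
  proof (rule tendsto_of_close_mono[where A = ?A and Q = ?Q and S = S and q = "\<lambda>x. exp (- (\<theta> * \<tau> x))"])
    show "mono (?A n)" "mono (?Q n)" for n
      by (auto intro!: monoI power_mono prob_below_mono prob_below_nonneg w_mono)
    show "isCont (\<lambda>x. exp (- (\<theta> * \<tau> x))) x"
      by (intro continuous_intros \<tau> x)
  qed (use S x Q close in auto)
qed

lemma partial_max_le_iff: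
  assumes "n > 0"
  shows "partial_max X n \<omega> \<le> w \<longleftrightarrow> (\<forall>t\<in>{1..int n}. X t \<omega> \<le> w)"
proof -
  have img: "{1..int n} = int ` {1..n}" by (simp add: image_int_atLeastAtMost)
  show ?thesis
    unfolding partial_max_def img using assms by (subst Max_le_iff) auto
qed

lemma prob_partial_max_le:
  "n > 0 \<Longrightarrow> prob {\<omega> \<in> space M. partial_max X n \<omega> \<le> w} = prob_below {1..int n} w"
  by (simp only: partial_max_le_iff prob_below_def)

lemma prob_partial_max_gt:
  assumes "n > 0"
  shows "prob {\<omega> \<in> space M. partial_max X n \<omega> > w} = 1 - prob_below {1..int n} w"
proof -
  have "{\<omega> \<in> space M. partial_max X n \<omega> > w}
      = space M - {\<omega> \<in> space M. \<forall>t\<in>{1..int n}. X t \<omega> \<le> w}"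
    using partial_max_le_iff[OF assms, of _ w] by (auto simp: not_le[symmetric] simp del: not_le)
  then show ?thesis
    using prob_below_sets[of "{1..int n}" w] by (simp add: prob_compl prob_below_def)
qed

end

text \<open>
  The function $\tau$ with $G_\gamma = \exp(-\tau)$, where $1 + \gamma x > 0$.
\<close>

definition gev_exponent :: "real \<Rightarrow> real \<Rightarrow> real" where
  "gev_exponent \<gamma> x = (if \<gamma> = 0 then exp (- x) else (1 + \<gamma> * x) powr (- 1 / \<gamma>))"

lemma gev_theta_eq_exp:
  "1 + \<gamma> * x > 0 \<Longrightarrow> gev_theta \<theta> \<gamma> x = exp (- (\<theta> * gev_exponent \<gamma> x))"
  by (simp add: gev_theta_def gev_exponent_def)

lemma isCont_gev_exponent: "1 + \<gamma> * x > 0 \<Longrightarrow> isCont (gev_exponent \<gamma>) x"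
  unfolding gev_exponent_def by (cases "\<gamma> = 0") (auto intro!: continuous_intros)

text \<open>
  Outside the support, \<open>gev_theta\<close> takes the value of its limit at the finite endpoint of the support,
  where $s = 1 + \gamma y$ decreases to 0.
\<close>

lemma gev_theta_boundary:
  assumes \<gamma>: "\<gamma> \<noteq> 0" and \<theta>: "\<theta> > 0" and x: "1 + \<gamma> * x \<le> 0" and d: "d > 0"
  obtains y where "1 + \<gamma> * y > 0" "\<bar>gev_theta \<theta> \<gamma> y - gev_theta \<theta> \<gamma> x\<bar> < d"
proof -
  have "((\<lambda>s. exp (- (\<theta> * s powr (- 1 / \<gamma>)))) \<longlongrightarrow> gev_theta \<theta> \<gamma> x) (at_right 0)"
  proof (cases "\<gamma> > 0")
    case True
    have "((\<lambda>s. exp (- (\<theta> * s powr (- 1 / \<gamma>)))) \<longlongrightarrow> 0) (at_right 0)"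
      using True \<theta> by real_asymp
    then show ?thesis using True x by (simp add: gev_theta_def)
  next
    case False
    then have "- 1 / \<gamma> > 0" using \<gamma> by (simp add: field_simps)
    then have "((\<lambda>s. exp (- (\<theta> * s powr (- 1 / \<gamma>)))) \<longlongrightarrow> 1) (at_right 0)"
      using \<theta> by real_asymp
    then show ?thesis using False \<gamma> x by (simp add: gev_theta_def)
  qed
  then have "\<forall>\<^sub>F s in at_right 0. dist (exp (- (\<theta> * s powr (- 1 / \<gamma>)))) (gev_theta \<theta> \<gamma> x) < d"
    using d by (rule tendstoD)
  then have "\<forall>\<^sub>F s in at_right 0. s > 0 \<and> dist (exp (- (\<theta> * s powr (- 1 / \<gamma>)))) (gev_theta \<theta> \<gamma> x) < d"
    using eventually_at_right_less[of 0] by eventually_elim simp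
  then obtain s :: real where s: "s > 0" "dist (exp (- (\<theta> * s powr (- 1 / \<gamma>)))) (gev_theta \<theta> \<gamma> x) < d"
    using eventually_happens trivial_limit_at_right_real by blast
  have "1 + \<gamma> * ((s - 1) / \<gamma>) = s" using \<gamma> by simp
  then show thesis
    using s \<gamma> by (intro that[of "(s - 1) / \<gamma>"]) (auto simp: gev_theta_def dist_real_def)
qed

theorem theorem5:
  fixes M :: "'a measure" and X :: "int \<Rightarrow> 'a \<Rightarrow> real"
    and F :: "real \<Rightarrow> real" and \<gamma> \<theta> :: real
    and u v :: "nat \<Rightarrow> real" and w :: "nat \<Rightarrow> real \<Rightarrow> real" and a l :: "nat \<Rightarrow> nat"
  assumes "prob_space M"
    and "strictly_stationary M X"
    and F: "F = cdf (distr M borel (X 0))"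
    and "absolutely_continuous lborel (distr M borel (X 0))"
    and "gev_domain_of_attraction F \<gamma>"
    and "gev_normalizing F \<gamma> u v"
    and w: "w = norm_level u v"
    and density_limit: "\<And>x. 1 + \<gamma> * x > 0 \<Longrightarrow>
      (\<forall>\<^sub>F n in sequentially. (\<lambda>y. F (w n y) ^ n) field_differentiable at x) \<and>
      (\<lambda>n. deriv (\<lambda>y. F (w n y) ^ n) x) \<longlonglongrightarrow> deriv (gev \<gamma>) x"
    and "\<And>n. a n > 0"
    and "(\<lambda>n. real (a n)) \<in> o(\<lambda>n. real n)"
    and "0 < \<theta>" "\<theta> \<le> 1"
    and extremal_index: "\<And>x. 1 + \<gamma> * x > 0 \<Longrightarrow>
      (\<lambda>n. measure M {\<omega> \<in> space M. partial_max X (a n) \<omega> > w n x} /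
            (real (a n) * (1 - F (w n x)))) \<longlonglongrightarrow> \<theta>"
    and "\<And>n. l n > 0"
    and "(\<lambda>n. real (l n)) \<in> o(\<lambda>n. real (a n))"
    and dependence:
      "(eta_weakly_dependent M X \<and>
         (\<lambda>n. ennreal (real n / real (a n)) *
               ennroot 2 (ennreal (real n) * eta_coeff M X (l n) * ennreal (u n)))
           \<longlonglongrightarrow> 0) \<or>
       (lambda_weakly_dependent M X \<and>
         (\<lambda>n. ennreal (real n / real (a n)) *
               max (ennroot 2 (ennreal (real n) * lambda_coeff M X (l n) * ennreal (u n)))
                   (ennroot 3 (ennreal (real n) * ennreal (real (a n)) *
                                lambda_coeff M X (l n) * ennreal ((u n)\<^sup>2))))
           \<longlonglongrightarrow> 0)"
  shows "\<And>x. (\<lambda>n. measure M {\<omega> \<in> space M. partial_max X n \<omega> \<le> w n x})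
               \<longlonglongrightarrow> gev_theta \<theta> \<gamma> x"
proof -
  interpret stationary_sequence M X
    using assms(1,2) by (simp add: stationary_sequence_def stationary_sequence_axioms_def)
  let ?A = "\<lambda>n x. prob_below {1..int n} (w n x)"
  let ?S = "{x. 1 + \<gamma> * x > 0}"
  have F': "F = marginal_cdf" using F by (simp add: marginal_cdf_def)
  have a: "\<And>n. a n > 0" and \<theta>: "\<theta> > 0" by fact+
  have u: "\<And>n. u n > 0" and gev_lim: "\<And>x. (\<lambda>n. F (w n x) ^ n) \<longlonglongrightarrow> gev \<gamma> x"
    using \<open>gev_normalizing F \<gamma> u v\<close> by (auto simp: gev_normalizing_def w)
  obtain e where scale: "smoothing_scale M X u a l e"
    using dependence eta_smoothing_scale[of u a M X l] lambda_smoothing_scale[of u a M X l] u a by blast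

  have tail: "(\<lambda>n. n * (1 - F (w n x))) \<longlonglongrightarrow> gev_exponent \<gamma> x" if "x \<in> ?S" for x
  proof (rule tendsto_mult_one_minus_of_power)
    show "(\<lambda>n. F (w n x) ^ n) \<longlonglongrightarrow> exp (- gev_exponent \<gamma> x)"
      using gev_lim[of x] that by (simp add: gev_def gev_theta_eq_exp)
  qed (simp_all add: F' marginal_cdf_nonneg marginal_cdf_le_1)

  have block_tail: "(\<lambda>n. n / a n * (1 - prob_below {1..int (a n)} (w n x)))
      \<longlonglongrightarrow> \<theta> * gev_exponent \<gamma> x" if x: "x \<in> ?S" for x
  proof -
    have pos: "gev_exponent \<gamma> x > 0" using x by (simp add: gev_exponent_def)
    have "\<forall>\<^sub>F n in sequentially. n * (1 - F (w n x)) > 0"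
      using tail[OF x] pos by (rule order_tendstoD)
    then have "\<forall>\<^sub>F n in sequentially. measure M {\<omega> \<in> space M. partial_max X (a n) \<omega> > w n x} /
            (real (a n) * (1 - F (w n x))) * (n * (1 - F (w n x)))
        = n / a n * (1 - prob_below {1..int (a n)} (w n x))"
    proof eventually_elim
      case (elim n)
      have cancel: "p / (r * d) * (s * d) = s / r * p" if "d \<noteq> 0" for p r s d :: real
        using that by simp
      show ?case using elim prob_partial_max_gt[OF a] by (subst cancel) auto
    qed
    moreover have "(\<lambda>n. measure M {\<omega> \<in> space M. partial_max X (a n) \<omega> > w n x} /
            (real (a n) * (1 - F (w n x))) * (n * (1 - F (w n x)))) \<longlonglongrightarrow> \<theta> * gev_exponent \<gamma> x"
      using x by (intro tendsto_mult tail extremal_index) auto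
    ultimately show ?thesis by (rule Lim_transform_eventually[rotated])
  qed

  have interior: "(\<lambda>n. ?A n x) \<longlonglongrightarrow> gev_theta \<theta> \<gamma> x" if x: "x \<in> ?S" for x
  proof -
    have "(\<lambda>n. prob_below {1..int n} (norm_level u v n x)) \<longlonglongrightarrow> exp (- (\<theta> * gev_exponent \<gamma> x))"
    proof (rule prob_below_limit[where a = a and l = l and S = ?S and \<tau> = "gev_exponent \<gamma>"])
      show "(\<lambda>n. real (a n) / real n) \<longlonglongrightarrow> 0" "(\<lambda>n. real (l n) / real (a n)) \<longlonglongrightarrow> 0"
        by (intro smalloD_tendsto; fact)+
      show "open ?S" by (intro open_Collect_less continuous_intros)
    qed (use u a assms(14) scale x tail block_tail in
        \<open>auto simp: F'[symmetric] w[symmetric] intro: isCont_gev_exponent\<close>)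
    then show ?thesis using x by (simp add: gev_theta_eq_exp w)
  qed

  have A_mono: "y \<le> z \<Longrightarrow> ?A n y \<le> ?A n z" for n y z
    using u[of n] by (intro prob_below_mono) (auto simp: w norm_level_def divide_right_mono)

  have limit: "(\<lambda>n. ?A n x) \<longlonglongrightarrow> gev_theta \<theta> \<gamma> x" for x
  proof (cases "x \<in> ?S")
    case False
    then have x: "1 + \<gamma> * x \<le> 0" and \<gamma>: "\<gamma> \<noteq> 0" by auto
    show ?thesis
    proof (rule tendstoI)
      fix d :: real assume "d > 0"
      then have d2: "d / 2 > 0" by simp
      obtain y where y: "1 + \<gamma> * y > 0" "\<bar>gev_theta \<theta> \<gamma> y - gev_theta \<theta> \<gamma> x\<bar> < d / 2"
        using gev_theta_boundary[OF \<gamma> \<theta> x d2] .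
      \<comment> \<open>The limit at \<open>x\<close> is 0 or 1, an extreme value for a probability, so monotonicity puts \<open>?A n x\<close> between it and \<open>?A n y\<close>.\<close>
      have between: "\<bar>?A n x - gev_theta \<theta> \<gamma> x\<bar> \<le> \<bar>?A n y - gev_theta \<theta> \<gamma> x\<bar>" for n
      proof (cases "\<gamma> > 0")
        case True
        then have "\<gamma> * x < \<gamma> * y" using x y by linarith
        then have "x \<le> y" using True by simp
        then show ?thesis
          using True x A_mono[of x y n] prob_below_nonneg by (simp add: gev_theta_def)
      next
        case False
        then have neg: "\<gamma> < 0" using \<gamma> by simp
        have "\<gamma> * x < \<gamma> * y" using x y by linarith
        then have "y \<le> x" using neg by simp
        then show ?thesis
          using neg x A_mono[of y x n] prob_below_le_1 by (simp add: gev_theta_def)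
      qed
      have "\<forall>\<^sub>F n in sequentially. dist (?A n y) (gev_theta \<theta> \<gamma> y) < d / 2"
        using interior[of y] y d2 by (intro tendstoD) auto
      then show "\<forall>\<^sub>F n in sequentially. dist (?A n x) (gev_theta \<theta> \<gamma> x) < d"
      proof eventually_elim
        case (elim n)
        then show ?case using between[of n] y(2) unfolding dist_real_def by linarith
      qed
    qed
  qed (rule interior)

  show "(\<lambda>n. measure M {\<omega> \<in> space M. partial_max X n \<omega> \<le> w n x}) \<longlonglongrightarrow> gev_theta \<theta> \<gamma> x" for x
    by (rule Lim_transform_eventually[OF limit[of x]])
      (use eventually_gt_at_top[of 0] in \<open>eventually_elim, simp add: prob_partial_max_le\<close>)
qed

end
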